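(* Let $\alpha>0$. Let $M$ be a finite complex measure on the closed unit disc $\overline{\mathbb D}$ and $\Sigma$ a locally finite complex measure on the closed right half-plane $\overline{\mathbb C^+}$, linked by $$dM(z)=2\alpha(\zeta+\alpha)^{-2}\,d\Sigma(\zeta),\qquad z=\frac{\zeta-\alpha}{\zeta+\alpha}$$ (so that $M(\{1\})=0$), and suppose that $$|M|(\overline{\mathbb D})=2\alpha\int_{\overline{\mathbb C^+}}|\zeta+\alpha|^{-2}\,d|\Sigma|(\zeta)<\infty .$$ Let $$a_n=\int_{\overline{\mathbb D}}z^n\,dM(z),\quad n=0,1,\ldots,\qquad \mathbf a(t)=\int_{\overline{\mathbb C^+}}e^{-\zeta t}\,d\Sigma(\zeta),\quad t>0,$$ where the second formula is understood in the sense of distributions on the class $\mathcal X$ (see context). Let $h[f,f]$, $f\in\mathcal D_+$, and $\mathbf h[\mathbf f,\mathbf f]$, $\mathbf f\in\mathcal Y$, be the corresponding Hankel quadratic forms. Then for all $f\in\mathcal D_+$, $$h[f,f]=\mathbf h[\mathcal Lf,\mathcal Lf].$$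
   Context: Notation. $\mathbb Z_+=\{0,1,2,\ldots\}$, $\mathbb R_+=(0,\infty)$, $\mathbb D=\{|z|<1\}$, $\mathbb C^+=\{\operatorname{Re}\zeta>0\}$; overlines on these sets denote closures. $|M|$, $|\Sigma|$ denote the variations of the complex measures. The relation $dM(z)=2\alpha(\zeta+\alpha)^{-2}d\Sigma(\zeta)$, $z=(\zeta-\alpha)/(\zeta+\alpha)$, means that $M$ is the image of the measure $2\alpha(\zeta+\alpha)^{-2}d\Sigma(\zeta)$ under the map $\zeta\mapsto z$ (with $M(\{1\})=0$). $\mathcal D_+\subset\ell^2(\mathbb Z_+)$ is the set of sequences $f=\{f_n\}_{n\ge0}$ with finitely many non-zero components. The discrete Hankel form is $h[f,f]=\sum_{n,m\in\mathbb Z_+}a_{n+m}f_m\overline{f_n}$, $f\in\mathcal D_+$. $\mathcal X$ is the set of $\mathbf F\in C^\infty(\mathbb R_+)$ such that the limits $\mathbf F^{(k)}(+0)$ exist for $k=0,1,2$, $\mathbf F(+0)=0$, and $\mathbf F^{(k)}\in L^1(\mathbb R_+)$ for $k=0,1,2$. The distribution $\mathbf a$ is defined on $\mathcal X$ by $\langle\mathbf a,\mathbf F\rangle=\int_{\overline{\mathbb C^+}}\big(\int_0^\infty e^{-\zeta t}\mathbf F(t)\,dt\big)d\Sigma(\zeta)$. $\mathcal Y$ is the set of $\mathbf f\in C^\infty(\mathbb R_+)$ such that the limits $\mathbf f^{(k)}(+0)$ exist and $\mathbf f^{(k)}\in L^1(\mathbb R_+)$ for $k=0,1,2$. For $\mathbf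 f\in\mathcal Y$ the function $\mathbf F(t)=\int_0^t\mathbf f(s)\overline{\mathbf f(t-s)}\,ds$ lies in $\mathcal X$, and the continuous Hankel form is $\mathbf h[\mathbf f,\mathbf f]=\langle\mathbf a,\mathbf F\rangle$ (formally $\int_0^\infty\mathbf a(t)\mathbf F(t)\,dt$). The Laguerre transform is the unitary operator $\mathcal L:\ell^2(\mathbb Z_+)\to L^2(\mathbb R_+)$ given by $(\mathcal Lf)(t)=-i(2\alpha)^{1/2}\sum_{n=0}^\infty f_n\,\mathsf L_n(2\alpha t)e^{-\alpha t}$ (with the same $\alpha$), where $\mathsf L_n(t)=\frac{1}{n!}e^t\frac{d^n}{dt^n}(e^{-t}t^n)$ are the Laguerre polynomials. It maps $\mathcal D_+$ into $\mathcal Y$. *)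

theory Defs
  imports "HOL-Analysis.Analysis"
begin

text \<open>
  The distribution, the two Hankel forms and the Laguerre transform are given on exactly the
  domain on which they are considered, via \<open>\<lambda>x\<in>A. t\<close>, which is undefined off \<open>A\<close>.
\<close>

definition bounded_borel :: "complex set \<Rightarrow> complex set set"
  where "bounded_borel X = {A \<in> sets borel. A \<subseteq> X \<and> bounded A}"

text \<open>
  A locally finite complex measure on a closed set \<open>X\<close> is a complex-valued, countably additive
  set function on the bounded Borel subsets of \<open>X\<close>; its values on other sets are irrelevant.
  Convergence is automatically absolute, as it holds for every reordering, and the variation is
  finite on bounded sets, as each trace on a bounded set is a complex measure on a
  \<open>\<sigma>\<close>-algebra. If \<open>X\<close> is bounded, this is a (finite) complex measure on the Borel sets of \<open>X\<close>.
\<close>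

definition locally_finite_complex_measure :: "complex set \<Rightarrow> (complex set \<Rightarrow> complex) \<Rightarrow> bool"
  where "locally_finite_complex_measure X \<mu> \<longleftrightarrow>
    (\<forall>A::nat \<Rightarrow> complex set. range A \<subseteq> bounded_borel X \<longrightarrow> disjoint_family A \<longrightarrow> bounded (\<Union>i. A i) \<longrightarrow>
      (\<lambda>i. \<mu> (A i)) sums \<mu> (\<Union>i. A i))"

text \<open>
  The variation of \<open>\<mu>\<close>, as a positive measure on all Borel sets of the plane concentrated on \<open>X\<close>.
  Finite families of disjoint bounded subsets (not necessarily covering \<open>A\<close>) give the same
  supremum as countable partitions, and make sense when \<open>A\<close> is unbounded.
\<close>

definition variation :: "complex set \<Rightarrow> (complex set \<Rightarrow> complex) \<Rightarrow> complex measure"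
  where "variation X \<mu> = measure_of UNIV (sets borel)
    (\<lambda>A. SUP P \<in> {P. finite P \<and> disjoint P \<and> P \<subseteq> bounded_borel X \<and> \<Union>P \<subseteq> A}.
      \<Sum>E\<in>P. ennreal (cmod (\<mu> E)))"

text \<open>
  The positive part of the Jordan decomposition of a real set function \<open>\<nu>\<close> on the bounded Borel
  subsets of \<open>X\<close>; \<open>ennreal\<close> truncates negative values to 0. The negative part is the positive part
  of \<open>-\<nu>\<close>.
\<close>

definition positive_part :: "complex set \<Rightarrow> (complex set \<Rightarrow> real) \<Rightarrow> complex measure"
  where "positive_part X \<nu> = measure_of UNIV (sets borel)
    (\<lambda>A. SUP B \<in> {B \<in> bounded_borel X. B \<subseteq> A}. ennreal (\<nu> B))"

text \<open>Meaningful only if \<open>g\<close> is \<open>|\<mu>|\<close>-integrable over \<open>X\<close>, i.e. integrable for all four parts.\<close>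

definition cm_integral :: "complex set \<Rightarrow> (complex set \<Rightarrow> complex) \<Rightarrow> (complex \<Rightarrow> complex) \<Rightarrow> complex"
  where "cm_integral X \<mu> g =
      ((LINT z:X|positive_part X (\<lambda>B. Re (\<mu> B)). g z) - (LINT z:X|positive_part X (\<lambda>B. - Re (\<mu> B)). g z))
    + \<i> * ((LINT z:X|positive_part X (\<lambda>B. Im (\<mu> B)). g z) - (LINT z:X|positive_part X (\<lambda>B. - Im (\<mu> B)). g z))"

abbreviation closed_disc :: "complex set"
  where "closed_disc \<equiv> cball 0 1"

definition closed_half_plane :: "complex set"
  where "closed_half_plane = {\<zeta>. 0 \<le> Re \<zeta>}"

definition cayley :: "real \<Rightarrow> complex \<Rightarrow> complex"
  where "cayley \<alpha> \<zeta> = (\<zeta> - of_real \<alpha>) / (\<zeta> + of_real \<alpha>)"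

text \<open>
  Functions on \<open>(0,\<infinity>)\<close> are total functions whose values on \<open>(-\<infinity>,0]\<close> are never used; in particular
  \<open>nth_vderiv k F t\<close> is only considered for \<open>t > 0\<close>.
\<close>

definition nth_vderiv :: "nat \<Rightarrow> (real \<Rightarrow> complex) \<Rightarrow> real \<Rightarrow> complex"
  where "nth_vderiv k = (\<lambda>G t. vector_derivative G (at t)) ^^ k"

definition smooth_half_line :: "(real \<Rightarrow> complex) \<Rightarrow> bool"
  where "smooth_half_line F \<longleftrightarrow> (\<forall>k. \<forall>t>0. nth_vderiv k F differentiable (at t))"

definition class_Y :: "(real \<Rightarrow> complex) set"
  where "class_Y = {F. smooth_half_line F \<and>
    (\<forall>k\<le>2. (\<exists>l. (nth_vderiv k F \<longlongrightarrow> l) (at_right 0)) \<and> set_integrable lborel {0<..} (nth_vderiv k F))}"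

definition class_X :: "(real \<Rightarrow> complex) set"
  where "class_X = {F \<in> class_Y. (F \<longlongrightarrow> 0) (at_right 0)}"

definition laplace_distribution :: "(complex set \<Rightarrow> complex) \<Rightarrow> (real \<Rightarrow> complex) \<Rightarrow> complex"
  where "laplace_distribution \<sigma> = (\<lambda>F\<in>class_X.
    cm_integral closed_half_plane \<sigma> (\<lambda>\<zeta>. LINT t:{0<..}|lborel. exp (- \<zeta> * of_real t) * F t))"

definition D_plus :: "(nat \<Rightarrow> complex) set"
  where "D_plus = {f. finite {n. f n \<noteq> 0}}"

definition discrete_hankel_form :: "(nat \<Rightarrow> complex) \<Rightarrow> (nat \<Rightarrow> complex) \<Rightarrow> complex"
  where "discrete_hankel_form a = (\<lambda>f\<in>D_plus.
    \<Sum>n | f n \<noteq> 0. \<Sum>m | f m \<noteq> 0. a (n + m) * f m * cnj (f n))"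

definition continuous_hankel_form :: "((real \<Rightarrow> complex) \<Rightarrow> complex) \<Rightarrow> (real \<Rightarrow> complex) \<Rightarrow> complex"
  where "continuous_hankel_form T = (\<lambda>f\<in>class_Y.
    T (\<lambda>t. LINT s:{0<..<t}|lborel. f s * cnj (f (t - s))))"

definition laguerre :: "nat \<Rightarrow> real \<Rightarrow> real"
  where "laguerre n t = 1 / fact n * exp t * (deriv ^^ n) (\<lambda>s. exp (- s) * s ^ n) t"

text \<open>
  The restriction to \<open>D_plus\<close> of the unitary operator from \<open>\<ell>\<^sup>2\<close> onto \<open>L\<^sup>2(0,\<infinity>)\<close>; the image is given
  by its smooth representative.
\<close>

definition laguerre_transform :: "real \<Rightarrow> (nat \<Rightarrow> complex) \<Rightarrow> real \<Rightarrow> complex"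
  where "laguerre_transform \<alpha> = (\<lambda>f\<in>D_plus. \<lambda>t.
    - \<i> * of_real (sqrt (2 * \<alpha>)) *
      (\<Sum>n | f n \<noteq> 0. f n * of_real (laguerre n (2 * \<alpha> * t)) * of_real (exp (- \<alpha> * t))))"

end

theory Submission
  imports Defs "HOL-Computational_Algebra.Polynomial"
begin

text \<open>
  Under the Laguerre transform the Cayley map becomes visible: the Laplace transform of the \<open>n\<close>th
  basis function \<open>L\<^sub>n(2\<alpha>t) e\<^sup>-\<^sup>\<alpha>\<^sup>t\<close> is \<open>(\<zeta> - \<alpha>)\<^sup>n / (\<zeta> + \<alpha>)\<^sup>n\<^sup>+\<^sup>1\<close>, that is, \<open>z\<^sup>n / (\<zeta> + \<alpha>)\<close> with
  \<open>z = (\<zeta> - \<alpha>) / (\<zeta> + \<alpha>)\<close> (\<open>laplace_laguerre\<close>). The Laplace transform turns the autoconvolution in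
  the continuous Hankel form into a product, so for the Laguerre transform of \<open>f\<close> it equals
  \<open>2\<alpha> (\<zeta> + \<alpha>)\<^sup>-\<^sup>2 \<Sum> f\<^sub>m cnj f\<^sub>n z\<^sup>n\<^sup>+\<^sup>m\<close>; this is \<open>continuous_hankel_form_laguerre\<close>. The first factor is
  the density that links \<open>\<Sigma>\<close> to \<open>M\<close>. Integrating with respect to \<open>\<Sigma>\<close> and changing variables
  (\<open>cm_integral_transfer\<close>) therefore gives the integral of \<open>\<Sum> f\<^sub>m cnj f\<^sub>n z\<^sup>n\<^sup>+\<^sup>m\<close> with respect to \<open>M\<close>,
  which is the discrete form.

  The analytic side is elementary, because the transform of a finite sequence is a polynomial times
  \<open>e\<^sup>-\<^sup>\<alpha>\<^sup>t\<close>: derivatives, convolutions and Laplace transforms of such functions can be computed on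
  coefficients, and membership in the classes of test functions is immediate.

  The change of variables rests on the theory of complex measures given as set functions on bounded
  Borel sets. Suprema over finite disjoint families are shown to be measures
  (\<open>emeasure_partition_sup\<close>), which covers variations and positive parts alike. Positive parts are
  dominated by the variation, so finiteness of the latter yields the Jordan decomposition,
  integrability and dominated convergence.
\<close>

section \<open>Variations and positive parts as measures\<close>

text \<open>
  Variations and positive parts are both suprema of sums \<open>\<Sum>E\<in>P. q E\<close> over finite disjoint families
  \<open>P\<close>, with \<open>q\<close> the modulus in one case and the truncation at 0 in the other. What makes such a
  supremum a measure is that \<open>q\<close> is countably subadditive and vanishes on the empty set, so both are
  treated at once.
\<close>

definition partial_partitions :: "complex set \<Rightarrow> complex set \<Rightarrow> complex set set set"
  where "partial_partitions X A =
    {P. finite P \<and> disjoint P \<and> P \<subseteq> bounded_borel X \<and> \<Union>P \<subseteq> A}"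

definition partition_sup :: "complex set \<Rightarrow> (complex set \<Rightarrow> ennreal) \<Rightarrow> complex set \<Rightarrow> ennreal"
  where "partition_sup X q A = (SUP P \<in> partial_partitions X A. \<Sum>E\<in>P. q E)"

lemma bounded_borel_Int: "B \<in> bounded_borel X \<Longrightarrow> C \<in> sets borel \<Longrightarrow> B \<inter> C \<in> bounded_borel X"
  by (auto simp: bounded_borel_def intro: bounded_subset)

lemma bounded_borel_Diff: "B \<in> bounded_borel X \<Longrightarrow> C \<in> sets borel \<Longrightarrow> B - C \<in> bounded_borel X"
  by (auto simp: bounded_borel_def intro: bounded_subset)

lemma bounded_borel_empty: "{} \<in> bounded_borel X"
  by (auto simp: bounded_borel_def)

lemma bounded_borel_UN:
  "finite I \<Longrightarrow> (\<And>i. i \<in> I \<Longrightarrow> B i \<in> bounded_borel X) \<Longrightarrow> (\<Union>i\<in>I. B i) \<in> bounded_borel X"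
  by (auto simp: bounded_borel_def bounded_UN)

text \<open>
  Families inside disjoint sets can be merged; they can share only the empty set, which does not
  contribute.
\<close>

lemma partition_sup_superadditive:
  assumes q0: "q {} = 0" and AB: "A \<inter> B = {}"
  shows "partition_sup X q A + partition_sup X q B \<le> partition_sup X q (A \<union> B)"
proof -
  have ne: "partial_partitions X C \<noteq> {}" for C
    by (auto simp: partial_partitions_def intro!: exI[of _ "{}"])
  have sums: "(\<Sum>E\<in>P. q E) + (\<Sum>E\<in>Q. q E) \<le> partition_sup X q (A \<union> B)"
    if P: "P \<in> partial_partitions X A" and Q: "Q \<in> partial_partitions X B" for P Q
  proof -
    have "\<forall>E\<in>P \<inter> Q. q E = 0"
    proof
      fix E assume "E \<in> P \<inter> Q"
      then have "E \<subseteq> A \<inter> B"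
        using P Q by (auto simp: partial_partitions_def)
      then show "q E = 0" using AB q0 by simp
    qed
    then have "(\<Sum>E\<in>P. q E) + (\<Sum>E\<in>Q. q E) = (\<Sum>E\<in>P \<union> Q. q E)"
      using P Q by (subst sum.union_inter_neutral) (auto simp: partial_partitions_def)
    moreover have "P \<union> Q \<in> partial_partitions X (A \<union> B)"
    proof -
      have "disjoint (P \<union> Q)"
      proof (rule disjoint_union)
        show "\<Union>P \<inter> \<Union>Q = {}"
          using P Q AB by (fastforce simp: partial_partitions_def)
      qed (use P Q in \<open>auto simp: partial_partitions_def\<close>)
      then show ?thesis using P Q by (auto simp: partial_partitions_def)
    qed
    ultimately show ?thesis
      unfolding partition_sup_def by (metis SUP_upper)
  qed
  have "partition_sup X q A + partition_sup X q B
      = (SUP P\<in>partial_partitions X A. (\<Sum>E\<in>P. q E) + partition_sup X q B)"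
    by (subst partition_sup_def) (rule ennreal_SUP_add_left[OF ne, symmetric])
  also have "\<dots> \<le> partition_sup X q (A \<union> B)"
  proof (rule SUP_least)
    fix P assume P: "P \<in> partial_partitions X A"
    have "(\<Sum>E\<in>P. q E) + partition_sup X q B
        = (SUP Q\<in>partial_partitions X B. (\<Sum>E\<in>P. q E) + (\<Sum>E\<in>Q. q E))"
      by (subst partition_sup_def) (rule ennreal_SUP_add_right[OF ne])
    also have "\<dots> \<le> partition_sup X q (A \<union> B)"
      by (rule SUP_least) (rule sums[OF P])
    finally show "(\<Sum>E\<in>P. q E) + partition_sup X q B \<le> partition_sup X q (A \<union> B)" .
  qed
  finally show ?thesis .
qed

text \<open>
  A family inside \<open>\<Union>i. A i\<close> is cut into its traces on the \<open>A i\<close>.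
\<close>

lemma partition_sup_countably_subadditive:
  assumes q0: "q {} = 0"
    and q: "\<And>B. B \<in> bounded_borel X \<Longrightarrow> B \<subseteq> (\<Union>i. A i) \<Longrightarrow> q B \<le> (\<Sum>i. q (B \<inter> A i))"
    and A: "range A \<subseteq> sets borel" "disjoint_family A"
  shows "partition_sup X q (\<Union>i::nat. A i) \<le> (\<Sum>i. partition_sup X q (A i))"
  unfolding partition_sup_def[of X q "\<Union>i. A i"]
proof (rule SUP_least)
  fix P assume P: "P \<in> partial_partitions X (\<Union>i. A i)"
  have trace: "(\<Sum>E\<in>P. q (E \<inter> A i)) \<le> partition_sup X q (A i)" for i
  proof -
    have dis: "E \<inter> E' = {}" if "E \<in> P" "E' \<in> P" "E \<noteq> E'" for E E'
      using P that by (auto simp: partial_partitions_def disjoint_def)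
    have traces: "(\<lambda>E. E \<inter> A i) ` P \<in> partial_partitions X (A i)"
      unfolding partial_partitions_def
    proof (intro CollectI conjI)
      show "disjoint ((\<lambda>E. E \<inter> A i) ` P)"
        unfolding disjoint_def using dis by blast
      show "(\<lambda>E. E \<inter> A i) ` P \<subseteq> bounded_borel X"
        using P A(1) by (auto simp: partial_partitions_def intro!: bounded_borel_Int)
    qed (use P in \<open>auto simp: partial_partitions_def\<close>)
    have "(\<Sum>E\<in>(\<lambda>E. E \<inter> A i) ` P. q E) = (\<Sum>E\<in>P. (q \<circ> (\<lambda>E. E \<inter> A i)) E)"
      \<comment> \<open>Different members can have the same trace only if both traces are empty.\<close>
    proof (rule sum.reindex_nontrivial)
      fix E E' assume "E \<in> P" "E' \<in> P" "E \<noteq> E'" and eq: "E \<inter> A i = E' \<inter> A i"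
      then have "E \<inter> A i = {}" using dis by blast
      then show "q (E \<inter> A i) = 0" using q0 by simp
    qed (use P in \<open>simp add: partial_partitions_def\<close>)
    then show ?thesis
      unfolding partition_sup_def by (intro SUP_upper2[OF traces]) simp
  qed
  have "(\<Sum>E\<in>P. q E) \<le> (\<Sum>E\<in>P. \<Sum>i. q (E \<inter> A i))"
  proof (rule sum_mono)
    fix E assume "E \<in> P"
    then show "q E \<le> (\<Sum>i. q (E \<inter> A i))"
      using P by (intro q) (auto simp: partial_partitions_def)
  qed
  also have "\<dots> = (\<Sum>i. \<Sum>E\<in>P. q (E \<inter> A i))"
    by (rule suminf_sum[symmetric]) auto
  also have "\<dots> \<le> (\<Sum>i. partition_sup X q (A i))"
    by (intro suminf_le trace) auto
  finally show "(\<Sum>E\<in>P. q E) \<le> (\<Sum>i. partition_sup X q (A i))" .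
qed

lemma partition_sup_mono: "A \<subseteq> B \<Longrightarrow> partition_sup X q A \<le> partition_sup X q B"
  unfolding partition_sup_def
  by (rule SUP_subset_mono) (auto simp: partial_partitions_def)

lemma emeasure_partition_sup:
  assumes q0: "q {} = 0"
    and q: "\<And>B A. B \<in> bounded_borel X \<Longrightarrow> range A \<subseteq> sets borel \<Longrightarrow> disjoint_family A \<Longrightarrow>
      B \<subseteq> (\<Union>i::nat. A i) \<Longrightarrow> q B \<le> (\<Sum>i. q (B \<inter> A i))"
    and A: "A \<in> sets borel"
  shows "emeasure (measure_of UNIV (sets borel) (partition_sup X q)) A = partition_sup X q A"
proof (rule emeasure_measure_of_sigma[OF _ _ _ A])
  show "sigma_algebra (UNIV::complex set) (sets borel)"
    using sets.sigma_algebra_axioms[of "borel::complex measure"] by simp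
  have "partition_sup X q {} \<le> 0"
    unfolding partition_sup_def
  proof (rule SUP_least)
    fix P assume "P \<in> partial_partitions X {}"
    then have "\<And>E. E \<in> P \<Longrightarrow> E = {}" by (auto simp: partial_partitions_def)
    then have "\<And>E. E \<in> P \<Longrightarrow> q E = 0" using q0 by metis
    then show "(\<Sum>E\<in>P. q E) \<le> 0" by simp
  qed
  then show "positive (sets borel) (partition_sup X q)"
    by (simp add: positive_def)
  show "countably_additive (sets borel) (partition_sup X q)"
  proof (rule countably_additiveI)
    fix A :: "nat \<Rightarrow> complex set"
    assume A: "range A \<subseteq> sets borel" "disjoint_family A"
    \<comment> \<open>Superadditivity bounds the partial sums of the series.\<close>
    have fin: "(\<Sum>i<n. partition_sup X q (A i)) \<le> partition_sup X q (\<Union>i<n. A i)" for n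
    proof (induction n)
      case 0 show ?case by simp
    next
      case (Suc n)
      have "(\<Sum>i<Suc n. partition_sup X q (A i))
          \<le> partition_sup X q (\<Union>i<n. A i) + partition_sup X q (A n)"
        using Suc by (simp add: add_right_mono)
      also have "\<dots> \<le> partition_sup X q ((\<Union>i<n. A i) \<union> A n)"
      proof (rule partition_sup_superadditive[of q, OF q0])
        show "(\<Union>i<n. A i) \<inter> A n = {}"
          using A(2) unfolding disjoint_family_on_def by (auto; metis IntI UNIV_I empty_iff less_irrefl)
      qed
      also have "(\<Union>i<n. A i) \<union> A n = (\<Union>i<Suc n. A i)"
        by (auto simp: lessThan_Suc)
      finally show ?case .
    qed
    show "(\<Sum>i. partition_sup X q (A i)) = partition_sup X q (\<Union>i. A i)"
    proof (rule antisym)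
      show "(\<Sum>i. partition_sup X q (A i)) \<le> partition_sup X q (\<Union>i. A i)"
      proof (rule suminf_le_const)
        fix n
        have "partition_sup X q (\<Union>i<n. A i) \<le> partition_sup X q (\<Union>i. A i)"
          by (rule partition_sup_mono) auto
        with fin[of n] show "(\<Sum>i<n. partition_sup X q (A i)) \<le> partition_sup X q (\<Union>i. A i)"
          by (rule order_trans)
      qed auto
      show "partition_sup X q (\<Union>i. A i) \<le> (\<Sum>i. partition_sup X q (A i))"
        by (rule partition_sup_countably_subadditive[of q, OF q0 q A]) (use A in auto)
    qed
  qed
qed

text \<open>
  The values range over any normed space, so that the notion covers a locally finite complex measure
  together with the real set functions \<open>Re (c * \<mu> B)\<close> whose positive parts define the integral.
\<close>

definition locally_countably_additive ::
    "complex set \<Rightarrow> (complex set \<Rightarrow> 'a::real_normed_vector) \<Rightarrow> bool"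
  where "locally_countably_additive X \<nu> \<longleftrightarrow>
    (\<forall>A::nat \<Rightarrow> complex set. range A \<subseteq> bounded_borel X \<longrightarrow> disjoint_family A \<longrightarrow>
      bounded (\<Union>i. A i) \<longrightarrow> (\<lambda>i. \<nu> (A i)) sums \<nu> (\<Union>i. A i))"

lemma locally_countably_additive_complex_iff:
  "locally_countably_additive X \<mu> \<longleftrightarrow> locally_finite_complex_measure X \<mu>"
  by (simp add: locally_countably_additive_def locally_finite_complex_measure_def)

lemma locally_countably_additive_empty:
  assumes "locally_countably_additive X \<nu>" shows "\<nu> {} = 0"
proof -
  have "(\<lambda>i::nat. \<nu> {}) sums \<nu> (\<Union>i::nat. {})"
    using assms[unfolded locally_countably_additive_def, rule_format, of "\<lambda>_. {}"]
    by (auto simp: bounded_borel_empty disjoint_family_on_def)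
  then have "(\<lambda>i::nat. \<nu> {}) \<longlonglongrightarrow> 0" by (intro summable_LIMSEQ_zero sums_summable)
  then show ?thesis by (simp add: LIMSEQ_const_iff)
qed

lemma locally_countably_additive_sums:
  assumes \<nu>: "locally_countably_additive X \<nu>" and B: "B \<in> bounded_borel X"
    and A: "range A \<subseteq> sets borel" "disjoint_family A" "B \<subseteq> (\<Union>i::nat. A i)"
  shows "(\<lambda>i. \<nu> (B \<inter> A i)) sums \<nu> B"
proof -
  have "(\<lambda>i. \<nu> (B \<inter> A i)) sums \<nu> (\<Union>i. B \<inter> A i)"
  proof (rule \<nu>[unfolded locally_countably_additive_def, rule_format])
    show "range (\<lambda>i. B \<inter> A i) \<subseteq> bounded_borel X"
      using A(1) B by (auto intro: bounded_borel_Int)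
    show "disjoint_family (\<lambda>i. B \<inter> A i)"
      using A(2) by (auto simp: disjoint_family_on_def)
    show "bounded (\<Union>i. B \<inter> A i)"
      by (rule bounded_subset[of B]) (use B in \<open>auto simp: bounded_borel_def\<close>)
  qed
  moreover have "(\<Union>i. B \<inter> A i) = B" using A(3) by auto
  ultimately show ?thesis by simp
qed

lemma locally_countably_additive_split:
  assumes \<nu>: "locally_countably_additive X \<nu>" and B: "B \<in> bounded_borel X" and C: "C \<in> sets borel"
  shows "\<nu> B = \<nu> (B \<inter> C) + \<nu> (B - C)"
proof -
  have "(\<lambda>i. \<nu> (B \<inter> binaryset C (- C) i)) sums \<nu> B"
    by (rule locally_countably_additive_sums[OF \<nu> B])
       (use C in \<open>auto simp: range_binaryset_eq UN_binaryset_eq disjoint_family_on_def binaryset_def\<close>)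
  moreover have "(\<lambda>i. \<nu> (B \<inter> binaryset C (- C) i)) sums (\<Sum>i<2. \<nu> (B \<inter> binaryset C (- C) i))"
    by (rule sums_finite) (auto simp: binaryset_def locally_countably_additive_empty[OF \<nu>])
  ultimately show ?thesis
    by (simp add: sums_unique2 lessThan_Suc numeral_2_eq_2 binaryset_def Diff_eq add.commute)
qed

lemma locally_countably_additive_Union:
  assumes \<nu>: "locally_countably_additive X \<nu>"
    and P: "finite P" "disjoint P" "P \<subseteq> bounded_borel X"
  shows "\<nu> (\<Union>P) = (\<Sum>E\<in>P. \<nu> E)"
  using P
proof (induction P rule: finite_induct)
  case empty then show ?case by (simp add: locally_countably_additive_empty[OF \<nu>])
next
  case (insert E P)
  have "E \<inter> \<Union>P = {}"
    using insert.prems(1) insert.hyps(2) by (fastforce simp: disjoint_def)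
  then have "\<Union>(insert E P) \<inter> E = E" "\<Union>(insert E P) - E = \<Union>P" by auto
  moreover have "\<nu> (\<Union>(insert E P)) = \<nu> (\<Union>(insert E P) \<inter> E) + \<nu> (\<Union>(insert E P) - E)"
  proof (rule locally_countably_additive_split[OF \<nu>])
    show "\<Union>(insert E P) \<in> bounded_borel X"
      using bounded_borel_UN[of "insert E P" "\<lambda>E. E" X] insert.prems(2) insert.hyps(1) by auto
    show "E \<in> sets borel" using insert.prems(2) by (auto simp: bounded_borel_def)
  qed
  moreover have "disjoint P"
    using insert.prems(1) by (auto simp: disjoint_def)
  ultimately show ?case using insert by simp
qed

lemma norm_le_suminf_norm_trace:
  fixes \<nu> :: "complex set \<Rightarrow> 'a::real_normed_vector"
  assumes "locally_countably_additive X \<nu>" "B \<in> bounded_borel X"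
    "range A \<subseteq> sets borel" "disjoint_family A" "B \<subseteq> (\<Union>i::nat. A i)"
  shows "ennreal (norm (\<nu> B)) \<le> (\<Sum>i. ennreal (norm (\<nu> (B \<inter> A i))))"
proof (rule LIMSEQ_le_const2)
  have "(\<lambda>n. norm (\<Sum>i<n. \<nu> (B \<inter> A i))) \<longlonglongrightarrow> norm (\<nu> B)"
    using locally_countably_additive_sums[OF assms] unfolding sums_def by (rule tendsto_norm)
  then show "(\<lambda>n. ennreal (norm (\<Sum>i<n. \<nu> (B \<inter> A i)))) \<longlonglongrightarrow> ennreal (norm (\<nu> B))"
    by (rule tendsto_ennrealI)
  have "ennreal (norm (\<Sum>i<n. \<nu> (B \<inter> A i))) \<le> (\<Sum>i. ennreal (norm (\<nu> (B \<inter> A i))))" for n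
  proof -
    have "ennreal (norm (\<Sum>i<n. \<nu> (B \<inter> A i))) \<le> ennreal (\<Sum>i<n. norm (\<nu> (B \<inter> A i)))"
      by (intro ennreal_leI norm_sum)
    also have "\<dots> = (\<Sum>i<n. ennreal (norm (\<nu> (B \<inter> A i))))" by simp
    also have "\<dots> \<le> (\<Sum>i. ennreal (norm (\<nu> (B \<inter> A i))))"
      by (rule sum_le_suminf) auto
    finally show ?thesis .
  qed
  then show "\<exists>N. \<forall>n\<ge>N. ennreal (norm (\<Sum>i<n. \<nu> (B \<inter> A i))) \<le> (\<Sum>i. ennreal (norm (\<nu> (B \<inter> A i))))"
    by blast
qed

lemma ennreal_le_suminf_trace:
  fixes \<nu> :: "complex set \<Rightarrow> real"
  assumes "locally_countably_additive X \<nu>" "B \<in> bounded_borel X"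
    "range A \<subseteq> sets borel" "disjoint_family A" "B \<subseteq> (\<Union>i::nat. A i)"
  shows "ennreal (\<nu> B) \<le> (\<Sum>i. ennreal (\<nu> (B \<inter> A i)))"
proof (rule LIMSEQ_le_const2)
  show "(\<lambda>n. ennreal (\<Sum>i<n. \<nu> (B \<inter> A i))) \<longlonglongrightarrow> ennreal (\<nu> B)"
    using locally_countably_additive_sums[OF assms] unfolding sums_def by (rule tendsto_ennrealI)
  have "ennreal (\<Sum>i<n. \<nu> (B \<inter> A i)) \<le> (\<Sum>i. ennreal (\<nu> (B \<inter> A i)))" for n
  proof -
    have "ennreal (\<Sum>i<n. \<nu> (B \<inter> A i)) \<le> ennreal (\<Sum>i<n. max 0 (\<nu> (B \<inter> A i)))"
      by (intro ennreal_leI sum_mono) auto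
    also have "\<dots> = (\<Sum>i<n. ennreal (max 0 (\<nu> (B \<inter> A i))))" by simp
    also have "\<dots> = (\<Sum>i<n. ennreal (\<nu> (B \<inter> A i)))"
      by (intro sum.cong refl) (auto simp: max_def ennreal_neg)
    also have "\<dots> \<le> (\<Sum>i. ennreal (\<nu> (B \<inter> A i)))"
      by (rule sum_le_suminf) auto
    finally show ?thesis .
  qed
  then show "\<exists>N. \<forall>n\<ge>N. ennreal (\<Sum>i<n. \<nu> (B \<inter> A i)) \<le> (\<Sum>i. ennreal (\<nu> (B \<inter> A i)))"
    by blast
qed

lemma sets_variation [simp, measurable_cong]: "sets (variation X \<mu>) = sets borel"
  and space_variation [simp]: "space (variation X \<mu>) = UNIV"
  using sets.sigma_sets_eq[of "borel::complex measure"] by (simp_all add: variation_def)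

lemma sets_positive_part [simp, measurable_cong]: "sets (positive_part X \<nu>) = sets borel"
  and space_positive_part [simp]: "space (positive_part X \<nu>) = UNIV"
  using sets.sigma_sets_eq[of "borel::complex measure"] by (simp_all add: positive_part_def)

lemma emeasure_variation:
  assumes "locally_countably_additive X \<mu>" "A \<in> sets borel"
  shows "emeasure (variation X \<mu>) A = partition_sup X (\<lambda>E. ennreal (cmod (\<mu> E))) A"
proof -
  have "variation X \<mu> = measure_of UNIV (sets borel) (partition_sup X (\<lambda>E. ennreal (cmod (\<mu> E))))"
    by (simp add: variation_def partition_sup_def[abs_def] partial_partitions_def)
  then show ?thesis
    using assms
    by (simp add: emeasure_partition_sup norm_le_suminf_norm_trace locally_countably_additive_empty)
qed

text \<open>
  The supremum defining a positive part runs over single sets. It agrees with the one over families,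
  as the members of a family on which \<open>\<nu>\<close> is nonnegative can be replaced by their union.
\<close>

lemma SUP_eq_partition_sup:
  assumes \<nu>: "locally_countably_additive X \<nu>"
  shows "(SUP B \<in> {B \<in> bounded_borel X. B \<subseteq> A}. ennreal (\<nu> B))
    = partition_sup X (\<lambda>E. ennreal (\<nu> E)) A"
proof (rule antisym)
  show "(SUP B \<in> {B \<in> bounded_borel X. B \<subseteq> A}. ennreal (\<nu> B))
    \<le> partition_sup X (\<lambda>E. ennreal (\<nu> E)) A"
  proof (rule SUP_least)
    fix B assume "B \<in> {B \<in> bounded_borel X. B \<subseteq> A}"
    then have "{B} \<in> partial_partitions X A" by (auto simp: partial_partitions_def)
    then show "ennreal (\<nu> B) \<le> partition_sup X (\<lambda>E. ennreal (\<nu> E)) A"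
      unfolding partition_sup_def by (rule SUP_upper2) simp
  qed
  show "partition_sup X (\<lambda>E. ennreal (\<nu> E)) A
    \<le> (SUP B \<in> {B \<in> bounded_borel X. B \<subseteq> A}. ennreal (\<nu> B))"
    unfolding partition_sup_def
  proof (rule SUP_least)
    fix P assume P: "P \<in> partial_partitions X A"
    define Q where "Q = {E \<in> P. 0 \<le> \<nu> E}"
    have Q: "finite Q" "disjoint Q" "Q \<subseteq> bounded_borel X" "\<Union>Q \<subseteq> A"
      using P by (auto simp: partial_partitions_def Q_def disjoint_def)
    have "(\<Sum>E\<in>P. ennreal (\<nu> E)) = (\<Sum>E\<in>Q. ennreal (\<nu> E))"
      by (rule sum.mono_neutral_right)
         (use P in \<open>auto simp: Q_def partial_partitions_def ennreal_eq_0_iff\<close>)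
    also have "\<dots> = ennreal (\<Sum>E\<in>Q. \<nu> E)"
      by (rule sum_ennreal) (auto simp: Q_def)
    also have "\<dots> = ennreal (\<nu> (\<Union>Q))"
      by (simp add: locally_countably_additive_Union[OF \<nu> Q(1-3)])
    also have "\<dots> \<le> (SUP B \<in> {B \<in> bounded_borel X. B \<subseteq> A}. ennreal (\<nu> B))"
      using bounded_borel_UN[of Q "\<lambda>E. E" X] Q by (intro SUP_upper) auto
    finally show "(\<Sum>E\<in>P. ennreal (\<nu> E)) \<le> (SUP B \<in> {B \<in> bounded_borel X. B \<subseteq> A}. ennreal (\<nu> B))" .
  qed
qed

lemma emeasure_positive_part_partition:
  assumes "locally_countably_additive X \<nu>" "A \<in> sets borel"
  shows "emeasure (positive_part X \<nu>) A = partition_sup X (\<lambda>E. ennreal (\<nu> E)) A"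
  unfolding positive_part_def SUP_eq_partition_sup[OF assms(1)]
  using assms
  by (simp add: emeasure_partition_sup ennreal_le_suminf_trace locally_countably_additive_empty)

lemma emeasure_positive_part:
  assumes "locally_countably_additive X \<nu>" "A \<in> sets borel"
  shows "emeasure (positive_part X \<nu>) A = (SUP B \<in> {B \<in> bounded_borel X. B \<subseteq> A}. ennreal (\<nu> B))"
  using assms by (simp add: emeasure_positive_part_partition SUP_eq_partition_sup)

text \<open>
  For \<open>C \<subseteq> B\<close> additivity gives \<open>- \<nu> C = \<nu> (B - C) - \<nu> B\<close>. Taking the supremum over \<open>C\<close>, which also
  lets \<open>B - C\<close> run through the subsets of \<open>B\<close>, turns this into a relation between the two parts.
\<close>

lemma Jordan_decomposition:
  fixes \<nu> :: "complex set \<Rightarrow> real"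
  assumes \<nu>: "locally_countably_additive X \<nu>" and B: "B \<in> bounded_borel X"
    and fin: "emeasure (positive_part X \<nu>) B < \<infinity>"
  shows "emeasure (positive_part X (\<lambda>E. - \<nu> E)) B < \<infinity> \<and>
    \<nu> B = measure (positive_part X \<nu>) B - measure (positive_part X (\<lambda>E. - \<nu> E)) B"
proof -
  let ?p = "positive_part X \<nu>" and ?n = "positive_part X (\<lambda>E. - \<nu> E)"
  have \<nu>': "locally_countably_additive X (\<lambda>E. - \<nu> E)"
    using \<nu> by (auto simp: locally_countably_additive_def intro: sums_minus)
  have Bb: "B \<in> sets borel" using B by (simp add: bounded_borel_def)
  have p: "\<nu> C \<le> measure ?p B" if "C \<in> bounded_borel X" "C \<subseteq> B" for C
  proof -
    have "ennreal (\<nu> C) \<le> emeasure ?p B"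
      unfolding emeasure_positive_part[OF \<nu> Bb] using that by (intro SUP_upper) auto
    then have "ennreal (\<nu> C) \<le> ennreal (measure ?p B)"
      using fin by (simp add: emeasure_eq_ennreal_measure top.not_eq_extremum)
    then show ?thesis by (simp add: ennreal_le_iff)
  qed
  have n: "emeasure ?n B \<le> ennreal (measure ?p B - \<nu> B)"
    unfolding emeasure_positive_part[OF \<nu>' Bb]
  proof (rule SUP_least)
    fix C assume C: "C \<in> {C \<in> bounded_borel X. C \<subseteq> B}"
    then have Cb: "C \<in> sets borel" by (simp add: bounded_borel_def)
    have "\<nu> B = \<nu> C + \<nu> (B - C)"
      using locally_countably_additive_split[OF \<nu> B Cb] C by (simp add: Int_absorb1)
    moreover have "\<nu> (B - C) \<le> measure ?p B"
      by (rule p) (use B Cb in \<open>auto intro: bounded_borel_Diff\<close>)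
    ultimately show "ennreal (- \<nu> C) \<le> ennreal (measure ?p B - \<nu> B)"
      by (intro ennreal_leI) simp
  qed
  then have n_fin: "emeasure ?n B < \<infinity>"
    using le_less_trans by fastforce
  have "emeasure ?p B \<le> ennreal (measure ?n B + \<nu> B)"
    unfolding emeasure_positive_part[OF \<nu> Bb]
  proof (rule SUP_least)
    fix C assume C: "C \<in> {C \<in> bounded_borel X. C \<subseteq> B}"
    then have Cb: "C \<in> sets borel" by (simp add: bounded_borel_def)
    have "\<nu> B = \<nu> C + \<nu> (B - C)"
      using locally_countably_additive_split[OF \<nu> B Cb] C by (simp add: Int_absorb1)
    moreover have "ennreal (- \<nu> (B - C)) \<le> emeasure ?n B"
      unfolding emeasure_positive_part[OF \<nu>' Bb]
      by (intro SUP_upper) (use B Cb in \<open>auto intro: bounded_borel_Diff\<close>)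
    then have "ennreal (- \<nu> (B - C)) \<le> ennreal (measure ?n B)"
      using n_fin by (simp add: emeasure_eq_ennreal_measure top.not_eq_extremum)
    then have "- \<nu> (B - C) \<le> measure ?n B" by (simp add: ennreal_le_iff)
    ultimately show "ennreal (\<nu> C) \<le> ennreal (measure ?n B + \<nu> B)"
      by (intro ennreal_leI) simp
  qed
  moreover have "0 \<le> measure ?p B - \<nu> B" using p[OF B] by simp
  then have "measure ?n B \<le> measure ?p B - \<nu> B"
    using n n_fin by (simp add: emeasure_eq_ennreal_measure top.not_eq_extremum)
  moreover have "0 \<le> measure ?n B + \<nu> B"
  proof -
    have "ennreal (- \<nu> B) \<le> emeasure ?n B"
      unfolding emeasure_positive_part[OF \<nu>' Bb] using B by (intro SUP_upper) auto
    then have "ennreal (- \<nu> B) \<le> ennreal (measure ?n B)"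
      using n_fin by (simp add: emeasure_eq_ennreal_measure top.not_eq_extremum)
    then have "- \<nu> B \<le> measure ?n B" by (simp add: ennreal_le_iff)
    then show ?thesis by simp
  qed
  ultimately have "measure ?p B = measure ?n B + \<nu> B"
    using fin by (simp add: emeasure_eq_ennreal_measure top.not_eq_extremum)
  then show ?thesis using n_fin by simp
qed

section \<open>Integration with respect to a complex measure\<close>

lemma locally_countably_additive_Re_mult:
  "locally_countably_additive X \<mu> \<Longrightarrow> locally_countably_additive X (\<lambda>B. Re (c * \<mu> B))"
  unfolding locally_countably_additive_def by (intro allI impI sums_Re sums_mult) simp

text \<open>
  Everything that has to be integrable is compared with the variation by means of this inequality.
\<close>

lemma positive_part_le_variation:
  assumes \<mu>: "locally_countably_additive X \<mu>" and c: "cmod c \<le> 1"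
  shows "positive_part X (\<lambda>B. Re (c * \<mu> B)) \<le> variation X \<mu>"
proof (subst le_measure)
  show "\<forall>A\<in>sets (positive_part X (\<lambda>B. Re (c * \<mu> B))).
      emeasure (positive_part X (\<lambda>B. Re (c * \<mu> B))) A \<le> emeasure (variation X \<mu>) A"
  proof
    fix A assume "A \<in> sets (positive_part X (\<lambda>B. Re (c * \<mu> B)))"
    then have A: "A \<in> sets borel" by simp
    have le: "Re (c * \<mu> E) \<le> cmod (\<mu> E)" for E
    proof -
      have "Re (c * \<mu> E) \<le> cmod c * cmod (\<mu> E)"
        by (metis complex_Re_le_cmod norm_mult)
      also have "\<dots> \<le> cmod (\<mu> E)" using c by (simp add: mult_left_le_one_le)
      finally show ?thesis .
    qed
    show "emeasure (positive_part X (\<lambda>B. Re (c * \<mu> B))) A \<le> emeasure (variation X \<mu>) A"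
      unfolding emeasure_variation[OF \<mu> A] partition_sup_def
        emeasure_positive_part_partition[OF locally_countably_additive_Re_mult[OF \<mu>] A]
      by (rule SUP_subset_mono[OF order_refl], rule sum_mono, rule ennreal_leI, rule le)
  qed
qed simp

text \<open>
  The four positive measures that make up the integral, indexed by the direction \<open>\<i> ^ k\<close> that each of
  them contributes, so that one argument serves for all four.
\<close>

definition directional_part :: "complex set \<Rightarrow> (complex set \<Rightarrow> complex) \<Rightarrow> nat \<Rightarrow> complex measure"
  where "directional_part X \<mu> k = positive_part X (\<lambda>B. Re ((- \<i>) ^ k * \<mu> B))"

lemma sets_directional_part [simp, measurable_cong]: "sets (directional_part X \<mu> k) = sets borel"
  and space_directional_part [simp]: "space (directional_part X \<mu> k) = UNIV"
  by (simp_all add: directional_part_def)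

lemma directional_part_le_variation:
  "locally_countably_additive X \<mu> \<Longrightarrow> directional_part X \<mu> k \<le> variation X \<mu>"
  unfolding directional_part_def by (rule positive_part_le_variation) (simp_all add: norm_power)

lemma cm_integral_eq_sum_directional_parts:
  "cm_integral X \<mu> g = (\<Sum>k<4. \<i> ^ k * (LINT z:X|directional_part X \<mu> k. g z))"
  by (simp add: cm_integral_def directional_part_def eval_nat_numeral lessThan_Suc algebra_simps)

lemma nn_integral_directional_part_le:
  assumes "locally_countably_additive X \<mu>"
  shows "(\<integral>\<^sup>+z. f z \<partial>directional_part X \<mu> k) \<le> (\<integral>\<^sup>+z. f z \<partial>variation X \<mu>)"
  by (rule nn_integral_mono_measure) (use directional_part_le_variation[OF assms] in auto)

definition cm_integrable :: "complex set \<Rightarrow> (complex set \<Rightarrow> complex) \<Rightarrow> (complex \<Rightarrow> complex) \<Rightarrow> bool"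
  where "cm_integrable X \<mu> g \<longleftrightarrow> (\<forall>k. set_integrable (directional_part X \<mu> k) X g)"

lemma cm_integrableI:
  assumes \<mu>: "locally_countably_additive X \<mu>" and X [measurable]: "X \<in> sets borel"
    and g [measurable]: "g \<in> borel_measurable borel"
    and fin: "(\<integral>\<^sup>+z\<in>X. ennreal (cmod (g z)) \<partial>variation X \<mu>) < \<infinity>"
  shows "cm_integrable X \<mu> g"
  unfolding cm_integrable_def set_integrable_def
proof (intro allI integrableI_bounded)
  fix k
  have "(\<integral>\<^sup>+z. ennreal (norm (indicator X z *\<^sub>R g z)) \<partial>directional_part X \<mu> k)
      \<le> (\<integral>\<^sup>+z. ennreal (norm (indicator X z *\<^sub>R g z)) \<partial>variation X \<mu>)"
    by (rule nn_integral_directional_part_le[OF \<mu>])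
  also have "\<dots> = (\<integral>\<^sup>+z\<in>X. ennreal (cmod (g z)) \<partial>variation X \<mu>)"
    by (intro nn_integral_cong) (auto split: split_indicator)
  finally show "(\<integral>\<^sup>+z. ennreal (norm (indicator X z *\<^sub>R g z)) \<partial>directional_part X \<mu> k) < \<infinity>"
    using fin by (rule le_less_trans)
qed measurable

lemma cm_integral_cong:
  assumes "X \<in> sets borel" "\<And>z. z \<in> X \<Longrightarrow> g z = g' z"
  shows "cm_integral X \<mu> g = cm_integral X \<mu> g'"
  unfolding cm_integral_eq_sum_directional_parts
  by (intro sum.cong refl arg_cong2[where f="(*)"] set_lebesgue_integral_cong) (use assms in auto)

lemma cm_integral_sum:
  assumes "\<And>i. i \<in> I \<Longrightarrow> cm_integrable X \<mu> (g i)"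
  shows "cm_integral X \<mu> (\<lambda>z. \<Sum>i\<in>I. c i * g i z) = (\<Sum>i\<in>I. c i * cm_integral X \<mu> (g i))"
proof -
  have "(LINT z:X|directional_part X \<mu> k. (\<Sum>i\<in>I. c i * g i z))
      = (\<Sum>i\<in>I. c i * (LINT z:X|directional_part X \<mu> k. g i z))" for k
  proof -
    have "(LINT z:X|directional_part X \<mu> k. (\<Sum>i\<in>I. c i * g i z))
        = (LINT z|directional_part X \<mu> k. (\<Sum>i\<in>I. c i * (indicator X z *\<^sub>R g i z)))"
      unfolding set_lebesgue_integral_def by (simp add: scaleR_sum_right)
    also have "\<dots> = (\<Sum>i\<in>I. LINT z|directional_part X \<mu> k. c i * (indicator X z *\<^sub>R g i z))"
      using assms unfolding cm_integrable_def set_integrable_def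
      by (intro Bochner_Integration.integral_sum integrable_mult_right) auto
    also have "\<dots> = (\<Sum>i\<in>I. c i * (LINT z:X|directional_part X \<mu> k. g i z))"
      unfolding set_lebesgue_integral_def by (intro sum.cong refl integral_mult_right_zero)
    finally show ?thesis .
  qed
  then show ?thesis
    unfolding cm_integral_eq_sum_directional_parts
    by (simp add: sum_distrib_left mult.left_commute sum.swap[of _ I])
qed

text \<open>
  Finite variation on \<open>B\<close> makes all four parts finite there, so that the Jordan decompositions of the
  real and imaginary parts of \<open>\<mu>\<close> reassemble \<open>\<mu> B\<close>.
\<close>

lemma cm_integral_indicator:
  assumes \<mu>: "locally_countably_additive X \<mu>" and B: "B \<in> bounded_borel X"
    and fin: "emeasure (variation X \<mu>) B < \<infinity>"
  shows "cm_integral X \<mu> (indicator B) = \<mu> B"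
proof -
  have [measurable]: "B \<in> sets borel" using B by (simp add: bounded_borel_def)
  have q_fin: "emeasure (directional_part X \<mu> k) B < \<infinity>" for k
    using le_measureD3[OF directional_part_le_variation[OF \<mu>, of k], of B] fin by (simp add: le_less_trans)
  have q: "(LINT z:X|directional_part X \<mu> k. indicator B z) = complex_of_real (measure (directional_part X \<mu> k) B)" for k
  proof -
    have "indicator X z *\<^sub>R (indicator B z :: complex) = complex_of_real (indicator B z)" for z
      using B by (auto simp: bounded_borel_def split: split_indicator)
    then show ?thesis unfolding set_lebesgue_integral_def by simp
  qed
  have jordan: "Re ((- \<i>) ^ k * \<mu> B) = measure (directional_part X \<mu> k) B - measure (directional_part X \<mu> (k + 2)) B" for k
  proof -
    have "(\<lambda>E. - Re ((- \<i>) ^ k * \<mu> E)) = (\<lambda>E. Re ((- \<i>) ^ (k + 2) * \<mu> E))"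
      by (simp add: power_add)
    then show ?thesis
      using Jordan_decomposition[OF locally_countably_additive_Re_mult[OF \<mu>] B, of "(- \<i>) ^ k"] q_fin[of k]
      unfolding directional_part_def by simp
  qed
  have "cm_integral X \<mu> (indicator B)
      = (\<Sum>k<4. \<i> ^ k * complex_of_real (measure (directional_part X \<mu> k) B))"
    unfolding cm_integral_eq_sum_directional_parts q ..
  also have "\<dots> = \<mu> B"
    using jordan[of 0] jordan[of 1]
    by (intro complex_eqI) (simp_all add: eval_nat_numeral lessThan_Suc)
  finally show ?thesis .
qed

lemma cm_integral_dominated_convergence:
  assumes \<mu>: "locally_countably_additive X \<mu>" and X [measurable]: "X \<in> sets borel"
    and [measurable]: "g \<in> borel_measurable borel" "\<And>i. s i \<in> borel_measurable borel"
      "h \<in> borel_measurable borel"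
    and h: "(\<integral>\<^sup>+z\<in>X. ennreal (h z) \<partial>variation X \<mu>) < \<infinity>"
    and bound: "\<And>i z. z \<in> X \<Longrightarrow> cmod (s i z) \<le> h z"
    and lim: "\<And>z. z \<in> X \<Longrightarrow> (\<lambda>i. s i z) \<longlonglongrightarrow> g z"
  shows "(\<lambda>i. cm_integral X \<mu> (s i)) \<longlonglongrightarrow> cm_integral X \<mu> g"
  unfolding cm_integral_eq_sum_directional_parts set_lebesgue_integral_def
proof (rule tendsto_sum, rule tendsto_mult_left,
    rule integral_dominated_convergence[where w = "\<lambda>z. indicator X z *\<^sub>R h z"])
  fix k
  have h0: "0 \<le> h z" if "z \<in> X" for z
    using bound[OF that, of undefined] norm_ge_zero order_trans by blast
  show "integrable (directional_part X \<mu> k) (\<lambda>z. indicator X z *\<^sub>R h z)"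
  proof (rule integrableI_bounded)
    have "(\<integral>\<^sup>+z. ennreal (norm (indicator X z *\<^sub>R h z)) \<partial>directional_part X \<mu> k)
        \<le> (\<integral>\<^sup>+z. ennreal (norm (indicator X z *\<^sub>R h z)) \<partial>variation X \<mu>)"
      by (rule nn_integral_directional_part_le[OF \<mu>])
    also have "\<dots> = (\<integral>\<^sup>+z\<in>X. ennreal (h z) \<partial>variation X \<mu>)"
      by (intro nn_integral_cong) (auto split: split_indicator simp: h0)
    finally show "(\<integral>\<^sup>+z. ennreal (norm (indicator X z *\<^sub>R h z)) \<partial>directional_part X \<mu> k) < \<infinity>"
      using h by (rule le_less_trans)
  qed measurable
  show "AE z in directional_part X \<mu> k. (\<lambda>i. indicator X z *\<^sub>R s i z) \<longlonglongrightarrow> indicator X z *\<^sub>R g z"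
    by (intro AE_I2) (auto split: split_indicator simp: lim)
  show "AE z in directional_part X \<mu> k. norm (indicator X z *\<^sub>R s i z) \<le> indicator X z *\<^sub>R h z" for i
    by (intro AE_I2) (auto split: split_indicator simp: bound)
qed measurable

text \<open>
  Change of variables along \<open>\<phi>\<close> with density \<open>w\<close>: the hypothesis \<open>link\<close> is the case of indicator
  functions, which extends to simple functions by linearity and to bounded Borel functions by
  dominated convergence on both sides.
\<close>

lemma cm_integral_transfer:
  assumes \<mu>: "locally_countably_additive X \<mu>" and X [measurable]: "X \<in> sets borel" and bX: "bounded X"
    and \<tau>: "locally_countably_additive Y \<tau>" and Y [measurable]: "Y \<in> sets borel"
    and \<phi> [measurable]: "\<phi> \<in> borel_measurable borel" and \<phi>Y: "\<phi> ` Y \<subseteq> X"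
    and w [measurable]: "w \<in> borel_measurable borel"
    and \<mu>_fin: "emeasure (variation X \<mu>) X < \<infinity>"
    and w_fin: "(\<integral>\<^sup>+\<zeta>\<in>Y. ennreal (cmod (w \<zeta>)) \<partial>variation Y \<tau>) < \<infinity>"
    and link: "\<And>B. B \<in> sets borel \<Longrightarrow> B \<subseteq> X \<Longrightarrow>
      \<mu> B = cm_integral Y \<tau> (\<lambda>\<zeta>. indicator (\<phi> -` B) \<zeta> * w \<zeta>)"
    and g [measurable]: "g \<in> borel_measurable borel" and K: "\<And>z. z \<in> X \<Longrightarrow> cmod (g z) \<le> K"
  shows "cm_integral X \<mu> g = cm_integral Y \<tau> (\<lambda>\<zeta>. g (\<phi> \<zeta>) * w \<zeta>)"
proof -
  have simple: "cm_integral X \<mu> F = cm_integral Y \<tau> (\<lambda>\<zeta>. F (\<phi> \<zeta>) * w \<zeta>)"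
    if F: "simple_function borel F" for F :: "complex \<Rightarrow> complex"
  proof -
    define L where "L y = F -` {y} \<inter> X" for y
    have L [measurable]: "L y \<in> sets borel" for y
      using simple_functionD(2)[OF F, of "{y}"] by (auto simp: L_def)
    have LX: "L y \<subseteq> X" for y by (auto simp: L_def)
    have Lbb: "L y \<in> bounded_borel X" for y
      using LX L bounded_subset[OF bX LX] by (auto simp: bounded_borel_def)
    have L_fin: "emeasure (variation X \<mu>) (L y) < \<infinity>" for y
      using emeasure_mono[OF LX, of "variation X \<mu>" y] \<mu>_fin by (simp add: le_less_trans)
    have rep: "F z = (\<Sum>y\<in>range F. y * indicator (L y) z)" if "z \<in> X" for z
      using simple_functionD(1)[OF F] that by (simp add: L_def indicator_def sum.delta' if_distrib cong: if_cong)
    have "cm_integral X \<mu> F = cm_integral X \<mu> (\<lambda>z. \<Sum>y\<in>range F. y * indicator (L y) z)"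
      by (rule cm_integral_cong[OF X rep])
    also have "\<dots> = (\<Sum>y\<in>range F. y * cm_integral X \<mu> (indicator (L y)))"
    proof (rule cm_integral_sum, rule cm_integrableI[OF \<mu> X])
      fix y
      have "(\<integral>\<^sup>+z\<in>X. ennreal (cmod (indicator (L y) z)) \<partial>variation X \<mu>)
          = (\<integral>\<^sup>+z. indicator (L y) z \<partial>variation X \<mu>)"
        by (intro nn_integral_cong) (use LX[of y] in \<open>auto split: split_indicator\<close>)
      then show "(\<integral>\<^sup>+z\<in>X. ennreal (cmod (indicator (L y) z)) \<partial>variation X \<mu>) < \<infinity>"
        using L_fin by simp
    qed measurable
    also have "\<dots> = (\<Sum>y\<in>range F. y * cm_integral Y \<tau> (\<lambda>\<zeta>. indicator (\<phi> -` L y) \<zeta> * w \<zeta>))"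
      using LX by (simp add: cm_integral_indicator[OF \<mu> Lbb L_fin] flip: link)
    also have "\<dots> = cm_integral Y \<tau> (\<lambda>\<zeta>. \<Sum>y\<in>range F. y * (indicator (\<phi> -` L y) \<zeta> * w \<zeta>))"
    proof (rule cm_integral_sum[symmetric], rule cm_integrableI[OF \<tau> Y])
      fix y
      have [measurable]: "\<phi> -` L y \<in> sets borel"
        using measurable_sets[OF \<phi> L] by simp
      show "(\<lambda>\<zeta>. indicator (\<phi> -` L y) \<zeta> * w \<zeta>) \<in> borel_measurable borel" by measurable
      have "(\<integral>\<^sup>+\<zeta>\<in>Y. ennreal (cmod (indicator (\<phi> -` L y) \<zeta> * w \<zeta>)) \<partial>variation Y \<tau>)
          \<le> (\<integral>\<^sup>+\<zeta>\<in>Y. ennreal (cmod (w \<zeta>)) \<partial>variation Y \<tau>)"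
        by (intro nn_integral_mono) (auto split: split_indicator)
      then show "(\<integral>\<^sup>+\<zeta>\<in>Y. ennreal (cmod (indicator (\<phi> -` L y) \<zeta> * w \<zeta>)) \<partial>variation Y \<tau>) < \<infinity>"
        using w_fin by (rule le_less_trans)
    qed
    also have "\<dots> = cm_integral Y \<tau> (\<lambda>\<zeta>. F (\<phi> \<zeta>) * w \<zeta>)"
    proof (rule cm_integral_cong[OF Y])
      fix \<zeta> assume "\<zeta> \<in> Y"
      then have "F (\<phi> \<zeta>) = (\<Sum>y\<in>range F. y * indicator (L y) (\<phi> \<zeta>))"
        using \<phi>Y by (intro rep) auto
      moreover have "indicator (\<phi> -` L y) \<zeta> = (indicator (L y) (\<phi> \<zeta>) :: complex)" for y
        by (auto split: split_indicator)
      ultimately show "(\<Sum>y\<in>range F. y * (indicator (\<phi> -` L y) \<zeta> * w \<zeta>)) = F (\<phi> \<zeta>) * w \<zeta>"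
        by (simp add: sum_distrib_right mult.assoc)
    qed
    finally show ?thesis .
  qed
  obtain F where F: "\<And>i. simple_function borel (F i)" "\<And>z. (\<lambda>i. F i z) \<longlonglongrightarrow> g z"
    "\<And>i z. cmod (F i z) \<le> 2 * cmod (g z)"
    using borel_measurable_implies_sequence_metric[of g borel 0] by (auto simp: dist_norm)
  have F_meas [measurable]: "F i \<in> borel_measurable borel" for i
    using F(1) by (rule borel_measurable_simple_function)
  \<comment> \<open>The approximants are at most twice as far from 0 as \<open>g\<close>, whence the dominating functions
    \<open>2 * K\<close> and \<open>2 * K * cmod (w \<zeta>)\<close>.\<close>
  have bound: "cmod (F i z) \<le> 2 * K" if "z \<in> X" for i z
    using F(3)[of i z] K[OF that] by linarith
  have "(\<lambda>i. cm_integral X \<mu> (F i)) \<longlonglongrightarrow> cm_integral X \<mu> g"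
  proof (rule cm_integral_dominated_convergence[OF \<mu> X])
    have "(\<integral>\<^sup>+z\<in>X. ennreal (2 * K) \<partial>variation X \<mu>) = ennreal (2 * K) * emeasure (variation X \<mu>) X"
      by (rule nn_integral_cmult_indicator) simp
    then show "(\<integral>\<^sup>+z\<in>X. ennreal (2 * K) \<partial>variation X \<mu>) < \<infinity>"
      using \<mu>_fin by (simp add: ennreal_mult_less_top)
  qed (use bound F(2) in auto)
  moreover have "(\<lambda>i. cm_integral X \<mu> (F i)) \<longlonglongrightarrow> cm_integral Y \<tau> (\<lambda>\<zeta>. g (\<phi> \<zeta>) * w \<zeta>)"
    unfolding simple[OF F(1)]
  proof (rule cm_integral_dominated_convergence[OF \<tau> Y, where h = "\<lambda>\<zeta>. 2 * K * cmod (w \<zeta>)"])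
    have "(\<integral>\<^sup>+\<zeta>\<in>Y. ennreal (2 * K * cmod (w \<zeta>)) \<partial>variation Y \<tau>)
        = (\<integral>\<^sup>+\<zeta>. ennreal (2 * K) * (ennreal (cmod (w \<zeta>)) * indicator Y \<zeta>) \<partial>variation Y \<tau>)"
      by (intro nn_integral_cong) (simp only: ennreal_mult''[OF norm_ge_zero], rule mult.assoc)
    also have "\<dots> = ennreal (2 * K) * (\<integral>\<^sup>+\<zeta>\<in>Y. ennreal (cmod (w \<zeta>)) \<partial>variation Y \<tau>)"
      by (rule nn_integral_cmult) measurable
    finally show "(\<integral>\<^sup>+\<zeta>\<in>Y. ennreal (2 * K * cmod (w \<zeta>)) \<partial>variation Y \<tau>) < \<infinity>"
      using w_fin by (simp add: ennreal_mult_less_top)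
    show "cmod (F i (\<phi> \<zeta>) * w \<zeta>) \<le> 2 * K * cmod (w \<zeta>)" if "\<zeta> \<in> Y" for i \<zeta>
      using that \<phi>Y by (auto simp: norm_mult intro!: mult_right_mono bound)
    show "(\<lambda>i. F i (\<phi> \<zeta>) * w \<zeta>) \<longlonglongrightarrow> g (\<phi> \<zeta>) * w \<zeta>" if "\<zeta> \<in> Y" for \<zeta>
      by (intro tendsto_mult F(2) tendsto_const)
  qed measurable
  ultimately show ?thesis by (rule LIMSEQ_unique)
qed

section \<open>Laplace transforms of exponential polynomials\<close>

text \<open>
  Evaluated at \<open>\<zeta> + \<alpha>\<close>, this is the Laplace transform at \<open>\<zeta>\<close> of \<open>exp (- \<alpha> * t) * poly p t\<close>. Functions of
  that form include all Laguerre transforms of finite sequences and are closed under convolution and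
  differentiation.
\<close>

definition laplace_poly :: "complex \<Rightarrow> complex poly \<Rightarrow> complex"
  where "laplace_poly z p = (LINT t:{0<..}|lborel. exp (- z * of_real t) * poly p (of_real t))"

text \<open>
  The modulus of the integrand is that of the integrand of Euler's integral for
  \<open>Gamma (k + 1)\<close>, rescaled by \<open>Re z\<close>.
\<close>

lemma set_integrable_exp_power:
  assumes "0 < Re z"
  shows "set_integrable lborel {0<..} (\<lambda>t. exp (- z * of_real t) * complex_of_real t ^ k)"
proof -
  let ?g = "\<lambda>t. complex_of_real t powr (of_nat k + 1 - 1) / of_real (exp (Re z * t))"
  let ?h = "\<lambda>t. complex_of_real (t ^ k / exp (Re z * t))"
  have "?g absolutely_integrable_on {0<..}"
    by (rule absolutely_integrable_Gamma_integral) (use assms in auto)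
  moreover have "set_integrable lebesgue {0<..} ?g = set_integrable lebesgue {0<..} ?h"
    by (rule set_integrable_cong) (auto simp: powr_nat')
  ultimately have "set_integrable lebesgue {0<..} ?h" by blast
  then have "set_integrable lborel {0<..} ?h"
    unfolding set_integrable_def by (subst (asm) integrable_completion) auto
  then show ?thesis
  proof (rule set_integrable_bound)
    show "set_borel_measurable lborel {0<..} (\<lambda>t. exp (- z * of_real t) * complex_of_real t ^ k)"
      unfolding set_borel_measurable_def by measurable
    show "AE t in lborel. t \<in> {0<..} \<longrightarrow>
        norm (exp (- z * of_real t) * complex_of_real t ^ k) \<le> norm (?h t)"
    proof (intro AE_I2 impI)
      fix t :: real assume "t \<in> {0<..}"
      then show "norm (exp (- z * of_real t) * complex_of_real t ^ k) \<le> norm (?h t)"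
        by (simp add: norm_mult norm_power norm_divide norm_exp_eq_Re exp_minus field_simps)
    qed
  qed
qed

lemma set_integrable_exp_poly:
  assumes "0 < Re z"
  shows "set_integrable lborel {0<..} (\<lambda>t. exp (- z * of_real t) * poly p (complex_of_real t))"
proof -
  have "(\<lambda>t. indicator {0<..} t *\<^sub>R (exp (- z * of_real t) * poly p (complex_of_real t)))
    = (\<lambda>t. \<Sum>i\<le>degree p. coeff p i *
        (indicator {0<..} t *\<^sub>R (exp (- z * of_real t) * complex_of_real t ^ i)))"
    by (simp add: poly_altdef sum_distrib_left scaleR_sum_right algebra_simps)
  moreover have "integrable lborel (\<lambda>t. \<Sum>i\<le>degree p. coeff p i *
        (indicator {0<..} t *\<^sub>R (exp (- z * of_real t) * complex_of_real t ^ i)))"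
    using set_integrable_exp_power[OF assms] unfolding set_integrable_def
    by (intro Bochner_Integration.integrable_sum integrable_mult_right)
  ultimately show ?thesis
    unfolding set_integrable_def by simp
qed

lemma laplace_poly_smult: "laplace_poly z (smult c p) = c * laplace_poly z p"
  unfolding laplace_poly_def by (simp add: mult.left_commute)

lemma laplace_poly_sum:
  assumes "0 < Re z"
  shows "laplace_poly z (\<Sum>i\<in>I. p i) = (\<Sum>i\<in>I. laplace_poly z (p i))"
  unfolding laplace_poly_def set_lebesgue_integral_def poly_sum sum_distrib_left scaleR_sum_right
  by (rule Bochner_Integration.integral_sum)
     (use set_integrable_exp_poly[OF assms] in \<open>simp add: set_integrable_def\<close>)

lemma laplace_poly_diff:
  assumes "0 < Re z"
  shows "laplace_poly z (p - q) = laplace_poly z p - laplace_poly z q"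
  unfolding laplace_poly_def
  using set_integral_diff(2)[OF set_integrable_exp_poly[OF assms, of p] set_integrable_exp_poly[OF assms, of q]]
  by (simp add: algebra_simps)

lemma tendsto_exp_poly_at_top:
  assumes "0 < Re z"
  shows "((\<lambda>t. exp (- z * of_real t) * poly p (complex_of_real t)) \<longlongrightarrow> 0) at_top"
proof -
  have "((\<lambda>t. exp (- z * of_real t) * complex_of_real t ^ k) \<longlongrightarrow> 0) at_top" for k
  proof (rule tendsto_norm_zero_cancel)
    have "filterlim (\<lambda>t. Re z * t) at_top at_top"
      using assms by (intro filterlim_tendsto_pos_mult_at_top[OF tendsto_const] filterlim_ident)
    then have "((\<lambda>t. (Re z * t) ^ k / exp (Re z * t)) \<longlongrightarrow> 0) at_top"
      by (rule filterlim_compose[OF tendsto_power_div_exp_0])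
    then have "((\<lambda>t. (Re z * t) ^ k / exp (Re z * t) / Re z ^ k) \<longlongrightarrow> 0 / Re z ^ k) at_top"
      by (rule tendsto_divide) (use assms in auto)
    then have "((\<lambda>t. (Re z * t) ^ k / exp (Re z * t) / Re z ^ k) \<longlongrightarrow> 0) at_top"
      by simp
    moreover have "\<forall>\<^sub>F t in at_top. (Re z * t) ^ k / exp (Re z * t) / Re z ^ k
        = norm (exp (- z * of_real t) * complex_of_real t ^ k)"
      using eventually_ge_at_top[of 0]
    proof eventually_elim
      case (elim t)
      then show ?case
        using assms
          by (simp add: norm_mult norm_power norm_divide norm_exp_eq_Re power_mult_distrib exp_minus field_simps)
    qed
    ultimately show "((\<lambda>t. norm (exp (- z * of_real t) * complex_of_real t ^ k)) \<longlongrightarrow> 0) at_top"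
      by (rule Lim_transform_eventually)
  qed
  then have "((\<lambda>t. \<Sum>i\<le>degree p. coeff p i * (exp (- z * of_real t) * complex_of_real t ^ i))
      \<longlongrightarrow> (\<Sum>i\<le>degree p. coeff p i * 0)) at_top"
    by (intro tendsto_sum tendsto_mult tendsto_const)
  then show ?thesis
    by (simp add: poly_altdef sum_distrib_left mult.left_commute)
qed

lemma has_vector_derivative_exp_poly:
  "((\<lambda>t. exp (- z * of_real t) * poly p (complex_of_real t)) has_vector_derivative
    exp (- z * of_real t) * poly (pderiv p - smult z p) (of_real t)) (at t)"
proof -
  have "((\<lambda>u. exp (- z * u) * poly p u) has_field_derivative
      exp (- z * of_real t) * poly (pderiv p - smult z p) (of_real t)) (at (of_real t))"
    by (auto intro!: derivative_eq_intros simp: algebra_simps)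
  then show ?thesis
    by (rule has_vector_derivative_real_field)
qed

text \<open>
  Integration by parts. It yields both the transforms of the monomials and, through the Rodrigues
  formula, those of the Laguerre polynomials.
\<close>

lemma laplace_poly_pderiv:
  assumes z: "0 < Re z"
  shows "laplace_poly z (pderiv p) = z * laplace_poly z p - poly p 0"
proof -
  let ?F = "\<lambda>p t. exp (- z * of_real t) * poly p (complex_of_real t)"
  have "(LBINT t=0..\<infinity>. ?F (pderiv p - smult z p) t) = 0 - ?F p 0"
  proof (rule interval_integral_FTC_integrable)
    show "(?F p has_vector_derivative ?F (pderiv p - smult z p) t) (at t)" for t
      by (rule has_vector_derivative_exp_poly)
    show "isCont (?F (pderiv p - smult z p)) t" for t
      by (rule has_vector_derivative_continuous[OF has_vector_derivative_exp_poly])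
    show "set_integrable lborel (einterval 0 \<infinity>) (?F (pderiv p - smult z p))"
      using set_integrable_exp_poly[OF z, of "pderiv p - smult z p"] by (simp add: zero_ereal_def)
    have "isCont (?F p) 0"
      by (rule has_vector_derivative_continuous[OF has_vector_derivative_exp_poly])
    then have "(?F p \<longlongrightarrow> ?F p 0) (at_right 0)"
      unfolding isCont_def by (rule filterlim_mono) (auto simp: at_le)
    then show "((?F p \<circ> real_of_ereal) \<longlongrightarrow> ?F p 0) (at_right 0)"
      by (simp add: zero_ereal_def ereal_tendsto_simps)
    show "((?F p \<circ> real_of_ereal) \<longlongrightarrow> 0) (at_left \<infinity>)"
      using tendsto_exp_poly_at_top[OF z] by (simp add: ereal_tendsto_simps)
  qed simp
  then have "laplace_poly z (pderiv p - smult z p) = - poly p 0"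
    by (simp add: zero_ereal_def interval_integral_to_infinity_eq laplace_poly_def)
  then show ?thesis
    by (simp add: laplace_poly_diff[OF z] laplace_poly_smult algebra_simps)
qed

lemma laplace_poly_monom:
  assumes z: "0 < Re z"
  shows "laplace_poly z (monom c k) = c * fact k / z ^ Suc k"
proof -
  have z0: "z \<noteq> 0" using z by auto
  have "laplace_poly z (monom 1 k) = fact k / z ^ Suc k"
  proof (induction k)
    case 0
    have "laplace_poly z 0 = 0" using laplace_poly_smult[of z 0 0] by simp
    then show ?case
      using laplace_poly_pderiv[OF z, of "monom 1 0"] z0 by (simp add: monom_0 pderiv_pCons field_simps)
  next
    case (Suc k)
    have "pderiv (monom 1 (Suc k)) = smult (of_nat (Suc k)) (monom (1::complex) k)"
      by (simp add: pderiv_monom smult_monom)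
    then have "of_nat (Suc k) * (fact k / z ^ Suc k) = z * laplace_poly z (monom 1 (Suc k))"
      using laplace_poly_pderiv[OF z, of "monom 1 (Suc k)"] Suc
      by (simp add: laplace_poly_smult poly_monom del: of_nat_Suc)
    then show ?case using z0 by (simp add: field_simps)
  qed
  then show ?thesis
    using laplace_poly_smult[of z c "monom 1 k"] by (simp add: smult_monom)
qed

lemma laplace_poly_altdef:
  assumes z: "0 < Re z"
  shows "laplace_poly z p = (\<Sum>i\<le>degree p. coeff p i * fact i / z ^ Suc i)"
proof -
  have "laplace_poly z (\<Sum>i\<le>degree p. monom (coeff p i) i) = (\<Sum>i\<le>degree p. coeff p i * fact i / z ^ Suc i)"
    by (simp add: laplace_poly_sum[OF z] laplace_poly_monom[OF z])
  then show ?thesis by (simp add: poly_as_sum_of_monoms)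
qed

text \<open>
  Euler's beta integral with integer parameters, by induction: integration by parts lowers the
  exponent of \<open>t - s\<close> at the expense of that of \<open>s\<close>.
\<close>

lemma has_integral_power_convolution:
  fixes t :: real
  assumes t: "0 \<le> t"
  shows "((\<lambda>s. s ^ m * (t - s) ^ n) has_integral
    fact m * fact n / fact (m + n + 1) * t ^ (m + n + 1)) {0..t}"
proof (induction n arbitrary: m)
  case 0
  have "((\<lambda>s. s ^ m) has_integral t ^ Suc m / (real m + 1) - 0 ^ Suc m / (real m + 1)) {0..t}"
  proof (rule fundamental_theorem_of_calculus[OF t])
    fix s assume "s \<in> {0..t}"
    have "((\<lambda>s. s ^ Suc m / (real m + 1)) has_real_derivative s ^ m) (at s within {0..t})"
      by (rule derivative_eq_intros refl | simp)+ (simp add: divide_simps)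
    then show "((\<lambda>s. s ^ Suc m / (real m + 1)) has_vector_derivative s ^ m) (at s within {0..t})"
      by (simp add: has_real_derivative_iff_has_vector_derivative)
  qed
  moreover have "fact m / fact (Suc m) = 1 / (real m + 1)"
    by (simp add: add.commute)
  ultimately show ?case by (simp del: fact_Suc)
next
  case (Suc n)
  let ?G = "\<lambda>s. s ^ Suc m / (real m + 1) * (t - s) ^ Suc n"
  let ?c = "(real n + 1) / (real m + 1)"
  have "((\<lambda>s. s ^ m * (t - s) ^ Suc n - ?c * (s ^ Suc m * (t - s) ^ n)) has_integral ?G t - ?G 0) {0..t}"
  proof (rule fundamental_theorem_of_calculus[OF t])
    fix s assume "s \<in> {0..t}"
    have "(?G has_real_derivative s ^ m * (t - s) ^ Suc n - ?c * (s ^ Suc m * (t - s) ^ n)) (at s within {0..t})"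
      by (rule derivative_eq_intros refl | simp)+ (simp add: divide_simps, simp add: algebra_simps)
    then show "(?G has_vector_derivative s ^ m * (t - s) ^ Suc n - ?c * (s ^ Suc m * (t - s) ^ n)) (at s within {0..t})"
      by (simp add: has_real_derivative_iff_has_vector_derivative)
  qed
  from has_integral_add[OF this has_integral_mult_right[OF Suc[of "Suc m"], of ?c]]
  have "((\<lambda>s. s ^ m * (t - s) ^ Suc n) has_integral
      ?c * (fact (Suc m) * fact n / fact (Suc m + n + 1) * t ^ (Suc m + n + 1))) {0..t}"
    by simp
  moreover have "?c * (fact (Suc m) * fact n / fact (Suc m + n + 1) * t ^ (Suc m + n + 1))
      = fact m * fact (Suc n) / fact (m + Suc n + 1) * t ^ (m + Suc n + 1)"
  proof -
    have "?c * (fact (Suc m) * fact n) = fact m * fact (Suc n)"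
      by (simp add: field_simps)
    moreover have "Suc m + n + 1 = m + Suc n + 1" by simp
    ultimately show ?thesis by (metis mult.assoc times_divide_eq_right)
  qed
  ultimately show ?case by simp
qed

text \<open>
  The polynomial \<open>\<integral>\<^sub>0\<^sup>t p(s) q(t - s) ds\<close>, with the beta integrals written out.
\<close>

definition conv_poly :: "complex poly \<Rightarrow> complex poly \<Rightarrow> complex poly"
  where "conv_poly p q = (\<Sum>i\<le>degree p. \<Sum>j\<le>degree q.
    monom (coeff p i * coeff q j * (fact i * fact j / fact (i + j + 1))) (i + j + 1))"

lemma set_integral_power_convolution:
  assumes "0 \<le> t"
  shows "set_integrable lborel {0<..<t} (\<lambda>s. complex_of_real s ^ m * complex_of_real (t - s) ^ n)"
    and "(LINT s:{0<..<t}|lborel. complex_of_real s ^ m * complex_of_real (t - s) ^ n)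
      = fact m * fact n / fact (m + n + 1) * complex_of_real t ^ (m + n + 1)"
proof -
  show int: "set_integrable lborel {0<..<t} (\<lambda>s. complex_of_real s ^ m * complex_of_real (t - s) ^ n)"
    by (rule set_integrable_subset[OF borel_integrable_atLeastAtMost'[of 0 t]])
       (auto intro!: continuous_intros)
  have "((\<lambda>s. of_real (s ^ m * (t - s) ^ n)) has_integral
      complex_of_real (fact m * fact n / fact (m + n + 1) * t ^ (m + n + 1))) {0..t}"
    using has_integral_linear[OF has_integral_power_convolution[OF assms],
        where h = complex_of_real] bounded_linear_of_real
    by (auto simp: o_def)
  then have "((\<lambda>s. of_real (s ^ m * (t - s) ^ n)) has_integral
      complex_of_real (fact m * fact n / fact (m + n + 1) * t ^ (m + n + 1))) {0<..<t}"
    by (simp only: has_integral_open_interval[where a=0 and b=t, unfolded box_real])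
  then show "(LINT s:{0<..<t}|lborel. complex_of_real s ^ m * complex_of_real (t - s) ^ n)
      = fact m * fact n / fact (m + n + 1) * complex_of_real t ^ (m + n + 1)"
    unfolding set_borel_integral_eq_integral(2)[OF int] by (simp add: integral_unique)
qed

lemma set_integral_poly_convolution:
  assumes t: "0 \<le> t"
  shows "(LINT s:{0<..<t}|lborel. poly p (complex_of_real s) * poly q (complex_of_real (t - s)))
    = poly (conv_poly p q) (of_real t)"
proof -
  let ?g = "\<lambda>i j s. indicator {0<..<t} s *\<^sub>R (complex_of_real s ^ i * complex_of_real (t - s) ^ j)"
  have "(LINT s:{0<..<t}|lborel. poly p (complex_of_real s) * poly q (complex_of_real (t - s)))
      = (LINT s|lborel. (\<Sum>i\<le>degree p. \<Sum>j\<le>degree q. coeff p i * coeff q j * ?g i j s))"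
    unfolding set_lebesgue_integral_def poly_altdef sum_product scaleR_sum_right
    by (intro Bochner_Integration.integral_cong sum.cong refl) (simp add: algebra_simps)
  also have "\<dots> = (\<Sum>i\<le>degree p. \<Sum>j\<le>degree q. coeff p i * coeff q j * (LINT s|lborel. ?g i j s))"
    by (simp only: Bochner_Integration.integral_sum Bochner_Integration.integrable_sum
        integrable_mult_right integral_mult_right_zero
        set_integral_power_convolution(1)[OF t, unfolded set_integrable_def])
  also have "\<dots> = poly (conv_poly p q) (of_real t)"
    using set_integral_power_convolution(2)[OF t, unfolded set_lebesgue_integral_def]
    by (simp add: conv_poly_def poly_sum poly_monom mult.assoc del: of_real_diff)
  finally show ?thesis .
qed

text \<open>
  The factorials in the transforms of \<open>t ^ i\<close> and \<open>t ^ j\<close> are the numerator of the beta integral, and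
  its denominator cancels the factorial in the transform of \<open>t ^ (i + j + 1)\<close>. On these functions the
  convolution theorem is thus an identity of coefficients.
\<close>

lemma laplace_conv_poly:
  assumes z: "0 < Re z"
  shows "laplace_poly z (conv_poly p q) = laplace_poly z p * laplace_poly z q"
  unfolding laplace_poly_altdef[OF z, of p] laplace_poly_altdef[OF z, of q] sum_product
  unfolding conv_poly_def laplace_poly_sum[OF z] laplace_poly_monom[OF z]
  by (intro sum.cong refl) (simp add: power_add field_simps del: fact_Suc)

section \<open>Laguerre polynomials and the two Hankel forms\<close>

text \<open>
  The derivative, conjugated by multiplication with \<open>exp (- s)\<close>.
\<close>

definition exp_step :: "real poly \<Rightarrow> real poly"
  where "exp_step p = pderiv p - p"

lemma higher_deriv_exp_poly:
  "(deriv ^^ j) (\<lambda>s::real. exp (- s) * poly p s) = (\<lambda>s. exp (- s) * poly ((exp_step ^^ j) p) s)"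
proof (induction j)
  case (Suc j)
  have "deriv (\<lambda>s::real. exp (- s) * poly q s) = (\<lambda>s. exp (- s) * poly (exp_step q) s)" for q
    by (intro ext DERIV_imp_deriv) (auto intro!: derivative_eq_intros simp: exp_step_def algebra_simps)
  then show ?case by (simp add: Suc)
qed simp

definition laguerre_poly :: "nat \<Rightarrow> real poly"
  where "laguerre_poly n = smult (1 / fact n) ((exp_step ^^ n) (monom 1 n))"

lemma laguerre_eq_poly: "laguerre n t = poly (laguerre_poly n) t"
  using higher_deriv_exp_poly[of n "monom 1 n"]
  by (simp add: laguerre_def laguerre_poly_def poly_monom exp_minus)

text \<open>
  Each derivative lowers the order of vanishing at 0 by at most one. For \<open>i = 0\<close> this removes the
  boundary terms when the Rodrigues formula is integrated by parts.
\<close>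

lemma coeff_exp_step_monom:
  "i + j < n \<Longrightarrow> coeff ((exp_step ^^ j) (monom 1 n)) i = 0"
  by (induction j arbitrary: i) (simp_all add: exp_step_def coeff_pderiv)

definition rescale_poly :: "real \<Rightarrow> real poly \<Rightarrow> complex poly"
  where "rescale_poly c p = pcompose (map_poly of_real p) [:0, of_real c:]"

lemma poly_map_poly_of_real: "poly (map_poly of_real p) (of_real x) = complex_of_real (poly p x)"
  by (simp add: poly_altdef coeff_map_poly degree_map_poly)

lemma poly_rescale_poly: "poly (rescale_poly c p) (of_real t) = complex_of_real (poly p (c * t))"
  unfolding rescale_poly_def poly_pcompose
  using poly_map_poly_of_real[of p "c * t"] by (simp add: mult.commute)

lemma rescale_poly_exp_step:
  assumes "c \<noteq> 0"
  shows "rescale_poly c (exp_step p) = smult (1 / of_real c) (pderiv (rescale_poly c p)) - rescale_poly c p"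
proof -
  have "map_poly complex_of_real (exp_step p) = pderiv (map_poly of_real p) - map_poly of_real p"
    by (rule poly_eqI) (simp add: exp_step_def coeff_map_poly coeff_pderiv)
  then show ?thesis
    using assms by (simp add: rescale_poly_def pcompose_diff pderiv_pcompose pderiv_pCons)
qed

text \<open>
  Under the transform, a derivative in the rescaled variable becomes multiplication by \<open>z / c\<close> as long as
  there is no boundary term. Each of the \<open>n\<close> steps of the Rodrigues formula therefore contributes a
  factor \<open>z / c - 1\<close> to the transform of \<open>(c * t) ^ n\<close>. For \<open>z = \<zeta> + \<alpha>\<close> and \<open>c = 2 * \<alpha>\<close> the result is
  \<open>cayley \<alpha> \<zeta> ^ n / (\<zeta> + \<alpha>)\<close>.
\<close>

lemma laplace_laguerre:
  assumes z: "0 < Re z" and c: "0 < c"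
  shows "laplace_poly z (rescale_poly c (laguerre_poly n)) = (z - of_real c) ^ n / z ^ Suc n"
proof -
  let ?c = "complex_of_real c"
  let ?r = "\<lambda>j. rescale_poly c ((exp_step ^^ j) (monom 1 n))"
  have steps: "j \<le> n \<Longrightarrow> laplace_poly z (?r j) = (z / ?c - 1) ^ j * (?c ^ n * fact n / z ^ Suc n)" for j
  proof (induction j)
    case 0
    have "?r 0 = monom (?c ^ n) n"
      by (intro poly_ext)
         (simp add: rescale_poly_def map_poly_monom poly_pcompose poly_monom power_mult_distrib mult.commute)
    then show ?case by (simp add: laplace_poly_monom[OF z])
  next
    case (Suc j)
    have "poly (?r j) 0 = 0"
      using poly_rescale_poly[of c _ 0] coeff_exp_step_monom[of 0 j n] Suc.prems
      by (simp add: poly_0_coeff_0)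
    then have "laplace_poly z (?r (Suc j)) = (z / ?c - 1) * laplace_poly z (?r j)"
      using c by (simp add: rescale_poly_exp_step laplace_poly_diff[OF z] laplace_poly_smult
          laplace_poly_pderiv[OF z] algebra_simps)
    then show ?case using Suc by simp
  qed
  have "rescale_poly c (laguerre_poly n) = smult (1 / fact n) (?r n)"
    by (intro poly_eqI)
       (simp add: rescale_poly_def laguerre_poly_def map_poly_smult pcompose_smult)
  then have "laplace_poly z (rescale_poly c (laguerre_poly n)) = (z / ?c - 1) ^ n * ?c ^ n / z ^ Suc n"
    by (simp add: laplace_poly_smult steps)
  also have "(z / ?c - 1) ^ n * ?c ^ n = (z - ?c) ^ n"
    using c by (simp add: field_simps flip: power_mult_distrib)
  finally show ?thesis .
qed

text \<open>
  The function may differ from the exponential polynomial for \<open>t \<le> 0\<close>, as a convolution over \<open>(0, t)\<close>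
  does, which vanishes there.
\<close>

lemma nth_vderiv_exp_poly:
  assumes F: "\<And>t. 0 < t \<Longrightarrow> F t = exp (- z * of_real t) * poly p (complex_of_real t)"
  shows "0 < t \<Longrightarrow> nth_vderiv k F t = exp (- z * of_real t) *
    poly (((\<lambda>p. pderiv p - smult z p) ^^ k) p) (complex_of_real t)"
proof (induction k arbitrary: t)
  case 0 then show ?case by (simp add: nth_vderiv_def F)
next
  case (Suc k)
  have "(nth_vderiv k F has_vector_derivative exp (- z * of_real t) *
    poly (((\<lambda>p. pderiv p - smult z p) ^^ Suc k) p) (complex_of_real t)) (at t)"
    by (rule has_vector_derivative_transform_within_open[OF _ open_greaterThan[of 0]])
       (use has_vector_derivative_exp_poly Suc in auto)
  then show ?case
    by (simp add: nth_vderiv_def vector_derivative_at)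
qed

lemma exp_poly_in_class_Y:
  assumes z: "0 < Re z"
    and F: "\<And>t. 0 < t \<Longrightarrow> F t = exp (- z * of_real t) * poly p (complex_of_real t)"
  shows "F \<in> class_Y" and "(F \<longlongrightarrow> poly p 0) (at_right 0)"
proof -
  define q where "q k = ((\<lambda>p. pderiv p - smult z p) ^^ k) p" for k
  let ?E = "\<lambda>p t. exp (- z * of_real t) * poly p (complex_of_real t)"
  have eq: "nth_vderiv k F t = ?E (q k) t" if "0 < t" for k t
    unfolding q_def by (rule nth_vderiv_exp_poly, rule F, assumption, rule that)
  have diff: "nth_vderiv k F differentiable (at t)" if "0 < t" for k t
  proof -
    have "(nth_vderiv k F has_vector_derivative ?E (pderiv (q k) - smult z (q k)) t) (at t)"
      by (rule has_vector_derivative_transform_within_open[OF has_vector_derivative_exp_poly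
            open_greaterThan[of 0]]) (use that eq in auto)
    then show ?thesis by (rule differentiableI_vector)
  qed
  have lim: "(nth_vderiv k F \<longlongrightarrow> poly (q k) 0) (at_right 0)" for k
  proof (rule Lim_transform_eventually)
    have "isCont (?E (q k)) 0"
      by (rule has_vector_derivative_continuous[OF has_vector_derivative_exp_poly])
    then have "(?E (q k) \<longlongrightarrow> ?E (q k) 0) (at_right 0)"
      unfolding isCont_def by (rule filterlim_mono) (auto simp: at_le)
    then show "(?E (q k) \<longlongrightarrow> poly (q k) 0) (at_right 0)" by simp
    show "\<forall>\<^sub>F t in at_right 0. ?E (q k) t = nth_vderiv k F t"
      using eventually_at_right_less[of 0] by eventually_elim (simp add: eq)
  qed
  have int: "set_integrable lborel {0<..} (nth_vderiv k F)" for k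
    using set_integrable_exp_poly[OF z, of "q k"]
    by (subst set_integrable_cong[OF refl refl, of _ _ "?E (q k)"]) (auto simp: eq)
  show "F \<in> class_Y"
    unfolding class_Y_def smooth_half_line_def using diff lim int by blast
  show "(F \<longlongrightarrow> poly p 0) (at_right 0)"
    using lim[of 0] by (simp add: nth_vderiv_def q_def)
qed

lemma poly_conv_poly_0: "poly (conv_poly p q) 0 = 0"
  by (simp add: conv_poly_def poly_sum poly_monom)

text \<open>
  The convolution is again an exponential polynomial on the half-line, and vanishes at 0 because every
  term of \<open>conv_poly\<close> has positive degree. It therefore lies in the domain of the distribution, and
  its transform factors.
\<close>

lemma laplace_distribution_convolution:
  assumes \<alpha>: "0 < \<alpha>"
    and f: "\<And>t. 0 < t \<Longrightarrow> f t = exp (- of_real \<alpha> * of_real t) * poly p (complex_of_real t)"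
    and g: "\<And>t. 0 < t \<Longrightarrow> g t = exp (- of_real \<alpha> * of_real t) * poly q (complex_of_real t)"
  shows "laplace_distribution \<sigma> (\<lambda>t. LINT s:{0<..<t}|lborel. f s * g (t - s))
    = cm_integral closed_half_plane \<sigma>
        (\<lambda>\<zeta>. laplace_poly (\<zeta> + of_real \<alpha>) p * laplace_poly (\<zeta> + of_real \<alpha>) q)"
proof -
  define F where "F t = (LINT s:{0<..<t}|lborel. f s * g (t - s))" for t
  have F: "F t = exp (- of_real \<alpha> * of_real t) * poly (conv_poly p q) (complex_of_real t)"
    if t: "0 < t" for t
  proof -
    have "F t = (LINT s:{0<..<t}|lborel. exp (- of_real \<alpha> * of_real t) *
        (poly p (complex_of_real s) * poly q (complex_of_real (t - s))))"
      unfolding F_def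
    proof (rule set_lebesgue_integral_cong, simp, intro allI impI)
      fix s assume "s \<in> {0<..<t}"
      moreover have "exp (- of_real \<alpha> * of_real s) * exp (- of_real \<alpha> * of_real (t - s))
          = exp (- of_real \<alpha> * complex_of_real t)"
        by (simp add: algebra_simps flip: exp_add)
      ultimately show "f s * g (t - s) = exp (- of_real \<alpha> * of_real t) *
          (poly p (complex_of_real s) * poly q (complex_of_real (t - s)))"
        by (simp add: f g ac_simps del: of_real_diff)
    qed
    also have "\<dots> = exp (- of_real \<alpha> * of_real t) * poly (conv_poly p q) (of_real t)"
      using t by (simp only: set_integral_mult_right set_integral_poly_convolution less_imp_le)
    finally show ?thesis .
  qed
  have re: "0 < Re (complex_of_real \<alpha>)" using \<alpha> by simp
  have "F \<in> class_X"
    using exp_poly_in_class_Y[OF re, where F=F, OF F] by (simp add: class_X_def poly_conv_poly_0)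
  then have "laplace_distribution \<sigma> F
      = cm_integral closed_half_plane \<sigma> (\<lambda>\<zeta>. LINT t:{0<..}|lborel. exp (- \<zeta> * of_real t) * F t)"
    by (simp add: laplace_distribution_def)
  also have "\<dots> = cm_integral closed_half_plane \<sigma>
        (\<lambda>\<zeta>. laplace_poly (\<zeta> + of_real \<alpha>) p * laplace_poly (\<zeta> + of_real \<alpha>) q)"
  proof (rule cm_integral_cong)
    show "closed_half_plane \<in> sets borel"
      unfolding closed_half_plane_def by (intro borel_closed closed_halfspace_Re_ge)
    fix \<zeta> assume "\<zeta> \<in> closed_half_plane"
    then have z: "0 < Re (\<zeta> + of_real \<alpha>)" using \<alpha> by (simp add: closed_half_plane_def)
    have "(LINT t:{0<..}|lborel. exp (- \<zeta> * of_real t) * F t) = laplace_poly (\<zeta> + of_real \<alpha>) (conv_poly p q)"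
      unfolding laplace_poly_def
      by (rule set_lebesgue_integral_cong) (auto simp: F algebra_simps simp flip: exp_add)
    then show "(LINT t:{0<..}|lborel. exp (- \<zeta> * of_real t) * F t)
        = laplace_poly (\<zeta> + of_real \<alpha>) p * laplace_poly (\<zeta> + of_real \<alpha>) q"
      by (simp add: laplace_conv_poly[OF z])
  qed
  finally show ?thesis unfolding F_def .
qed

text \<open>
  The constant \<open>2 * \<alpha>\<close> in the density is the product of the normalising factor
  \<open>- \<i> * sqrt (2 * \<alpha>)\<close> of the Laguerre transform and its conjugate; the square in the denominator comes
  from the factors \<open>1 / (\<zeta> + \<alpha>)\<close> of the two transforms.
\<close>

lemma continuous_hankel_form_laguerre:
  assumes \<alpha>: "0 < \<alpha>" and f: "f \<in> D_plus"
  shows "continuous_hankel_form (laplace_distribution \<sigma>) (laguerre_transform \<alpha> f)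
    = cm_integral closed_half_plane \<sigma> (\<lambda>\<zeta>.
        (\<Sum>n | f n \<noteq> 0. \<Sum>m | f m \<noteq> 0. f m * cnj (f n) * cayley \<alpha> \<zeta> ^ (n + m))
        * (2 * of_real \<alpha> / (\<zeta> + of_real \<alpha>)\<^sup>2))"
proof -
  let ?l = "\<lambda>n. rescale_poly (2 * \<alpha>) (laguerre_poly n)"
  let ?e = "\<lambda>t. exp (- of_real \<alpha> * complex_of_real t)"
  let ?r = "complex_of_real (sqrt (2 * \<alpha>))"
  define p where "p = smult (- \<i> * ?r) (\<Sum>n | f n \<noteq> 0. smult (f n) (?l n))"
  define q where "q = smult (\<i> * ?r) (\<Sum>n | f n \<noteq> 0. smult (cnj (f n)) (?l n))"
  have e: "?e t = complex_of_real (exp (- \<alpha> * t))" for t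
    by (simp flip: exp_of_real)
  have p: "laguerre_transform \<alpha> f t = ?e t * poly p (complex_of_real t)" for t
    unfolding e using f
    by (simp add: laguerre_transform_def p_def poly_sum poly_rescale_poly laguerre_eq_poly
        sum_distrib_left sum_negf ac_simps)
  have q: "cnj (laguerre_transform \<alpha> f t) = ?e t * poly q (complex_of_real t)" for t
    unfolding e using f
    by (simp add: laguerre_transform_def q_def poly_sum poly_rescale_poly laguerre_eq_poly
        sum_distrib_left sum_negf ac_simps)
  have re: "0 < Re (complex_of_real \<alpha>)" using \<alpha> by simp
  have "laguerre_transform \<alpha> f \<in> class_Y"
    by (rule exp_poly_in_class_Y(1)[OF re p])
  then have "continuous_hankel_form (laplace_distribution \<sigma>) (laguerre_transform \<alpha> f)
    = cm_integral closed_half_plane \<sigma>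
        (\<lambda>\<zeta>. laplace_poly (\<zeta> + of_real \<alpha>) p * laplace_poly (\<zeta> + of_real \<alpha>) q)"
    unfolding continuous_hankel_form_def
    using laplace_distribution_convolution[OF \<alpha> p q, of \<sigma>] by simp
  also have "\<dots> = cm_integral closed_half_plane \<sigma> (\<lambda>\<zeta>.
        (\<Sum>n | f n \<noteq> 0. \<Sum>m | f m \<noteq> 0. f m * cnj (f n) * cayley \<alpha> \<zeta> ^ (n + m))
        * (2 * of_real \<alpha> / (\<zeta> + of_real \<alpha>)\<^sup>2))"
  proof (rule cm_integral_cong)
    show "closed_half_plane \<in> sets borel"
      unfolding closed_half_plane_def by (intro borel_closed closed_halfspace_Re_ge)
    fix \<zeta> assume "\<zeta> \<in> closed_half_plane"
    then have z: "0 < Re (\<zeta> + of_real \<alpha>)" using \<alpha> by (simp add: closed_half_plane_def)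
    let ?z = "\<zeta> + complex_of_real \<alpha>"
    have l: "laplace_poly ?z (?l n) = cayley \<alpha> \<zeta> ^ n / ?z" for n
      using laplace_laguerre[OF z, of "2 * \<alpha>" n] \<alpha>
      by (simp add: cayley_def power_divide algebra_simps)
    have "laplace_poly ?z p * laplace_poly ?z q
        = (- \<i> * ?r) * (\<i> * ?r) * ((\<Sum>n | f n \<noteq> 0. cnj (f n) * (cayley \<alpha> \<zeta> ^ n / ?z))
            * (\<Sum>n | f n \<noteq> 0. f n * (cayley \<alpha> \<zeta> ^ n / ?z)))"
      by (simp only: p_def q_def laplace_poly_smult laplace_poly_sum[OF z] l) (simp only: ac_simps)
    also have "(- \<i> * ?r) * (\<i> * ?r) = 2 * of_real \<alpha>"
      using \<alpha> by (simp add: algebra_simps flip: of_real_mult) simp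
    also have "(\<Sum>n | f n \<noteq> 0. cnj (f n) * (cayley \<alpha> \<zeta> ^ n / ?z))
            * (\<Sum>n | f n \<noteq> 0. f n * (cayley \<alpha> \<zeta> ^ n / ?z))
        = (\<Sum>n | f n \<noteq> 0. \<Sum>m | f m \<noteq> 0. f m * cnj (f n) * cayley \<alpha> \<zeta> ^ (n + m)) / ?z\<^sup>2"
      unfolding sum_product sum_divide_distrib
      by (intro sum.cong refl) (simp add: power_add power2_eq_square ac_simps)
    finally show "laplace_poly ?z p * laplace_poly ?z q
        = (\<Sum>n | f n \<noteq> 0. \<Sum>m | f m \<noteq> 0. f m * cnj (f n) * cayley \<alpha> \<zeta> ^ (n + m))
          * (2 * of_real \<alpha> / ?z\<^sup>2)"
      by simp
  qed
  finally show ?thesis .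
qed

lemma cmod_cayley_le_1:
  assumes "0 < \<alpha>" "\<zeta> \<in> closed_half_plane"
  shows "cmod (cayley \<alpha> \<zeta>) \<le> 1"
proof -
  have "(cmod (\<zeta> - of_real \<alpha>))\<^sup>2 \<le> (cmod (\<zeta> + of_real \<alpha>))\<^sup>2"
    unfolding cmod_power2 using assms by (simp add: closed_half_plane_def power2_eq_square algebra_simps)
  then have "cmod (\<zeta> - of_real \<alpha>) \<le> cmod (\<zeta> + of_real \<alpha>)"
    by (rule power2_le_imp_le) simp
  then show ?thesis
    by (simp add: cayley_def norm_divide divide_le_eq_1)
qed

text \<open>
  The discrete form is the integral of \<open>\<Sum>n. \<Sum>m. f m * cnj (f n) * z ^ (n + m)\<close> with respect to \<open>M\<close>,
  by linearity. That the two total masses agree and are finite makes the density integrable with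
  respect to the variation of \<open>\<sigma>\<close>, so that \<open>cm_integral_transfer\<close> applies.
\<close>

theorem theorem3p3:
  fixes \<alpha> :: real
    and M \<sigma> :: "complex set \<Rightarrow> complex"
    and a :: "nat \<Rightarrow> complex"
    and T :: "(real \<Rightarrow> complex) \<Rightarrow> complex"
  assumes alpha: "0 < \<alpha>"
    and M: "locally_finite_complex_measure closed_disc M"
    and S: "locally_finite_complex_measure closed_half_plane \<sigma>"
    and link: "\<And>B. B \<in> sets borel \<Longrightarrow> B \<subseteq> closed_disc \<Longrightarrow>
      M B = cm_integral closed_half_plane \<sigma>
        (\<lambda>\<zeta>. indicator (cayley \<alpha> -` B) \<zeta> * (2 * of_real \<alpha> / (\<zeta> + of_real \<alpha>)\<^sup>2))"
    and var_eq: "emeasure (variation closed_disc M) closed_disc =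
      ennreal (2 * \<alpha>) * (\<integral>\<^sup>+\<zeta>\<in>closed_half_plane.
        ennreal (1 / (cmod (\<zeta> + of_real \<alpha>))\<^sup>2) \<partial>variation closed_half_plane \<sigma>)"
    and var_finite: "emeasure (variation closed_disc M) closed_disc < \<infinity>"
    and a: "\<And>n. a n = cm_integral closed_disc M (\<lambda>z. z ^ n)"
    and T: "T = laplace_distribution \<sigma>"
  shows "\<forall>f\<in>D_plus. discrete_hankel_form a f = continuous_hankel_form T (laguerre_transform \<alpha> f)"
proof
  fix f assume f: "f \<in> D_plus"
  let ?w = "\<lambda>\<zeta>. 2 * of_real \<alpha> / (\<zeta> + of_real \<alpha>)\<^sup>2 :: complex"
  let ?K = "{n. f n \<noteq> 0}"
  let ?g = "\<lambda>z. \<Sum>n\<in>?K. \<Sum>m\<in>?K. f m * cnj (f n) * z ^ (n + m)"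
  have M': "locally_countably_additive closed_disc M"
    and S': "locally_countably_additive closed_half_plane \<sigma>"
    using M S by (simp_all add: locally_countably_additive_complex_iff)
  have [measurable]: "closed_half_plane \<in> sets borel"
    unfolding closed_half_plane_def by (intro borel_closed closed_halfspace_Re_ge)
  have w_fin: "(\<integral>\<^sup>+\<zeta>\<in>closed_half_plane. ennreal (cmod (?w \<zeta>)) \<partial>variation closed_half_plane \<sigma>) < \<infinity>"
  proof -
    have "(\<integral>\<^sup>+\<zeta>\<in>closed_half_plane. ennreal (cmod (?w \<zeta>)) \<partial>variation closed_half_plane \<sigma>)
      = (\<integral>\<^sup>+\<zeta>. ennreal (2 * \<alpha>) * (ennreal (1 / (cmod (\<zeta> + of_real \<alpha>))\<^sup>2)
          * indicator closed_half_plane \<zeta>) \<partial>variation closed_half_plane \<sigma>)"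
      using alpha
      by (intro nn_integral_cong)
         (simp add: norm_divide norm_mult norm_power split: split_indicator flip: ennreal_mult)
    also have "\<dots> = emeasure (variation closed_disc M) closed_disc"
      unfolding var_eq by (rule nn_integral_cmult) measurable
    finally show ?thesis using var_finite by simp
  qed
  have g_bound: "cmod (?g z) \<le> (\<Sum>n\<in>?K. \<Sum>m\<in>?K. cmod (f m * cnj (f n)))" if "z \<in> closed_disc" for z
  proof -
    have "cmod (z ^ (n + m)) \<le> 1" for n m
      using that by (simp add: norm_power power_le_one)
    then have "cmod (f m * cnj (f n) * z ^ (n + m)) \<le> cmod (f m * cnj (f n))" for n m
      by (metis mult_right_le_one_le norm_ge_zero norm_mult)
    then show ?thesis
      by (intro order_trans[OF norm_sum] sum_mono)
  qed
  have powers: "cm_integrable closed_disc M (\<lambda>z. z ^ n)" for n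
  proof (rule cm_integrableI[OF M'])
    have "(\<integral>\<^sup>+z\<in>closed_disc. ennreal (cmod (z ^ n)) \<partial>variation closed_disc M)
        \<le> (\<integral>\<^sup>+z. indicator closed_disc z \<partial>variation closed_disc M)"
      by (intro nn_integral_mono) (auto simp: norm_power power_le_one split: split_indicator)
    then show "(\<integral>\<^sup>+z\<in>closed_disc. ennreal (cmod (z ^ n)) \<partial>variation closed_disc M) < \<infinity>"
      using var_finite by (simp add: le_less_trans)
  qed measurable
  \<comment> \<open>The double sum is flattened to one over pairs in order to apply linearity once.\<close>
  have "discrete_hankel_form a f = (\<Sum>(n, m)\<in>?K \<times> ?K. f m * cnj (f n) * cm_integral closed_disc M (\<lambda>z. z ^ (n + m)))"
    using f by (simp add: discrete_hankel_form_def a sum.cartesian_product ac_simps)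
  also have "\<dots> = cm_integral closed_disc M (\<lambda>z. \<Sum>x\<in>?K \<times> ?K. f (snd x) * cnj (f (fst x)) * z ^ (fst x + snd x))"
    by (subst cm_integral_sum[OF powers]) (simp add: case_prod_unfold)
  also have "\<dots> = cm_integral closed_disc M ?g"
    by (simp add: sum.cartesian_product case_prod_unfold)
  also have "\<dots> = cm_integral closed_half_plane \<sigma> (\<lambda>\<zeta>. ?g (cayley \<alpha> \<zeta>) * ?w \<zeta>)"
  proof (rule cm_integral_transfer[OF M' _ _ S' _ _ _ _ var_finite w_fin link _ g_bound])
    show "cayley \<alpha> \<in> borel_measurable borel"
      unfolding cayley_def[abs_def] by measurable
    show "cayley \<alpha> ` closed_half_plane \<subseteq> closed_disc"
      using cmod_cayley_le_1[OF alpha] by auto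
  qed (simp_all, measurable)
  also have "\<dots> = continuous_hankel_form T (laguerre_transform \<alpha> f)"
    unfolding T continuous_hankel_form_laguerre[OF alpha f] ..
  finally show "discrete_hankel_form a f = continuous_hankel_form T (laguerre_transform \<alpha> f)" .
qed

end
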